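(* Let $X$ and $Y$ be independent, positive, non-degenerate random variables such that $\mathbb{E}X<\infty$, $\mathbb{E}Y<\infty$ and $\mathbb{E}X^{-1}<\infty$. Let $$U=\frac{Y}{1+X},\qquad V=X(1+U)=X\left(1+\frac{Y}{1+X}\right).$$ Suppose that there exist real constants $\alpha$ and $\beta$ such that, almost surely, $$\mathbb{E}(V\mid U)=\alpha\qquad\text{and}\qquad \mathbb{E}(V^{-1}\mid U)=\beta.$$ Then $\alpha\beta>1$ and there exists a constant $c>0$ such that $$X\sim\mathcal{K}\left(\frac{\alpha\beta}{\alpha\beta-1},\;c-\frac{\alpha\beta}{\alpha\beta-1},\;\frac{\beta}{\alpha\beta-1}\right)\qquad\text{and}\qquad Y\sim\mathcal{G}\left(c,\frac{\beta}{\alpha\beta-1}\right).$$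
   Context: For $a>0$, $b\in\mathbb{R}$, $c>0$, the Kummer distribution $\mathcal{K}(a,b,c)$ is the probability distribution on $(0,\infty)$ with density proportional to $\dfrac{x^{a-1}e^{-cx}}{(1+x)^{a+b}}\,I_{(0,\infty)}(x)$. For $b>0$, $c>0$, the gamma distribution $\mathcal{G}(b,c)$ is the probability distribution on $(0,\infty)$ with density proportional to $y^{b-1}e^{-cy}I_{(0,\infty)}(y)$. A random variable is non-degenerate if it is not almost surely constant. Writing that a variable has one of these distributions includes that the parameters are well defined and admissible. *)

theory Defs
  imports "HOL-Probability.Probability"
begin

definition nondegenerate :: "'a measure \<Rightarrow> ('a \<Rightarrow> real) \<Rightarrow> bool" where
  "nondegenerate M X \<longleftrightarrow> \<not> (\<exists>k. AE \<omega> in M. X \<omega> = k)"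

definition kummer_kernel :: "real \<Rightarrow> real \<Rightarrow> real \<Rightarrow> real \<Rightarrow> real" where
  "kummer_kernel a b c x =
     x powr (a - 1) * exp (- c * x) / (1 + x) powr (a + b) * indicator {0<..} x"

definition gamma_kernel :: "real \<Rightarrow> real \<Rightarrow> real \<Rightarrow> real" where
  "gamma_kernel b c y = y powr (b - 1) * exp (- c * y) * indicator {0<..} y"

text \<open>
  The two predicates below include the admissibility of the parameters.  On a probability
  space the constant \<open>K\<close> is forced to be the normalising constant of the kernel, because
  the law of the random variable has total mass one.
\<close>

definition kummer_distributed ::
    "'a measure \<Rightarrow> ('a \<Rightarrow> real) \<Rightarrow> real \<Rightarrow> real \<Rightarrow> real \<Rightarrow> bool" where
  "kummer_distributed M X a b c \<longleftrightarrow> a > 0 \<and> c > 0 \<and>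
     (\<exists>K>0. distributed M lborel X (\<lambda>x. ennreal (K * kummer_kernel a b c x)))"

definition gamma_distributed ::
    "'a measure \<Rightarrow> ('a \<Rightarrow> real) \<Rightarrow> real \<Rightarrow> real \<Rightarrow> bool" where
  "gamma_distributed M Y b c \<longleftrightarrow> b > 0 \<and> c > 0 \<and>
     (\<exists>K>0. distributed M lborel Y (\<lambda>y. ennreal (K * gamma_kernel b c y)))"

text \<open>
  Conditional expectation given a random variable, i.e. given the \<open>\<sigma>\<close>-algebra it generates.
\<close>

definition cond_exp_given ::
    "'a measure \<Rightarrow> ('a \<Rightarrow> real) \<Rightarrow> ('a \<Rightarrow> real) \<Rightarrow> 'a \<Rightarrow> real" where
  "cond_exp_given M V U = real_cond_exp M (vimage_algebra (space M) U borel) V"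

end

theory Submission
  imports Defs
begin

text \<open>
  Testing both regression conditions against powers of \<open>U\<close> and using independence gives two
  recurrences linking \<open>g n = E Y ^ n\<close>, \<open>f n = E (1 + X) ^ (- n)\<close> and \<open>h n = E (1 / (X * (1 + X) ^ n))\<close>.
  Eliminating \<open>h\<close>, which satisfies \<open>h n - h (n + 1) = f (n + 1)\<close>, cancels all \<open>f\<close>'s but one and leaves
  \<open>g (n + 2) / g (n + 1) = g (n + 1) / g n + (\<alpha> - 1 / \<beta>)\<close>. Hence \<open>Y\<close> has the moments of a gamma
  distribution, which determine its law. Finiteness of the moments follows inductively from the second
  condition.

  Once \<open>Y\<close> has a gamma density with parameters \<open>c\<close> and \<open>\<lambda>\<close>, the second condition, localised at \<open>U = u\<close>,
  says that \<open>L t = E ((1 + X) ^ c / X * exp (- t * X))\<close> satisfies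
  \<open>L t = - \<beta> * (1 + t / \<lambda>) * L' t\<close> for \<open>t = \<lambda> * u\<close>. So \<open>L t\<close> is a multiple of
  \<open>(1 + t / \<lambda>) powr (- \<lambda> / \<beta>)\<close>, and uniqueness of Laplace transforms identifies the law of \<open>X\<close>.
\<close>

section \<open>Moment and Laplace determinacy\<close>

lemma power_over_fact_le_exp:
  fixes x :: real assumes "0 \<le> x"
  shows "x ^ n / fact n \<le> exp x"
proof -
  have "(\<Sum>k\<in>{n}. x ^ k /\<^sub>R fact k) \<le> (\<Sum>k. x ^ k /\<^sub>R fact k)"
    using assms by (intro sum_le_suminf summable_exp_generic) auto
  then show ?thesis by (simp add: exp_def divide_inverse_commute)
qed

text \<open>The bound \<open>y ^ m / fact m \<le> exp y\<close> at \<open>y = d / 2 * x\<close> lets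
  half of the exponential rate absorb the power.\<close>

lemma power_times_exp_le:
  fixes x d :: real assumes x: "0 \<le> x" and d: "0 < d"
  shows "x ^ m * exp (d / 2 * x) \<le> fact m * (2 / d) ^ m * exp (d * x)"
proof -
  have "(d / 2 * x) ^ m / fact m \<le> exp (d / 2 * x)"
    using x d by (intro power_over_fact_le_exp) auto
  then have "x ^ m \<le> fact m * (2 / d) ^ m * exp (d / 2 * x)"
    using d by (simp add: field_simps power_mult_distrib power_divide)
  then have "x ^ m * exp (d / 2 * x) \<le> fact m * (2 / d) ^ m * exp (d / 2 * x) * exp (d / 2 * x)"
    by (intro mult_right_mono) auto
  also have "\<dots> = fact m * (2 / d) ^ m * exp (d * x)"
    by (simp add: mult.assoc flip: exp_add)
  finally show ?thesis .
qed

lemma (in real_distribution) integrable_power_iexp: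
  assumes d: "0 < d" and int: "integrable M (\<lambda>x. exp (d * x))" and nn: "AE x in M. 0 \<le> x"
  shows "integrable M (\<lambda>x. complex_of_real (x ^ m) * iexp (t * x))"
proof (rule Bochner_Integration.integrable_bound)
  show "integrable M (\<lambda>x. fact m * (2 / d) ^ m * exp (d * x))"
    using int by simp
  show "AE x in M. norm (complex_of_real (x ^ m) * iexp (t * x)) \<le> norm (fact m * (2 / d) ^ m * exp (d * x))"
    using nn
  proof eventually_elim
    case (elim x)
    have "x ^ m \<le> x ^ m * exp (d / 2 * x)"
      using elim d by (simp add: mult_le_cancel_left1)
    also note power_times_exp_le[OF elim d]
    finally show ?case using elim d by (simp add: norm_mult norm_power)
  qed
qed simp

text \<open>Expand \<open>exp (\<i> * (h * x))\<close> under the integral. For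
  \<open>\<bar>h\<bar> \<le> d / 2\<close> the partial sums are dominated by
  \<open>x ^ m * exp (d / 2 * x)\<close>, hence by an integrable function. The admissible step
  \<open>h\<close> depends neither on \<open>t\<close> nor on \<open>m\<close>.\<close>

lemma (in real_distribution) power_iexp_shift_sums:
  assumes d: "0 < d" and int: "integrable M (\<lambda>x. exp (d * x))" and nn: "AE x in M. 0 \<le> x"
    and h: "\<bar>h\<bar> \<le> d / 2"
  shows "(\<lambda>n. (\<i> * h) ^ n / fact n * (CLINT x|M. of_real (x ^ (m + n)) * iexp (t * x)))
           sums (CLINT x|M. of_real (x ^ m) * iexp ((t + h) * x))"
proof -
  define S :: "nat \<Rightarrow> real \<Rightarrow> complex"
    where "S N x = (\<Sum>n<N. (\<i> * h) ^ n / fact n * (of_real (x ^ (m + n)) * iexp (t * x)))" for N x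
  have S: "S N x = of_real (x ^ m) * iexp (t * x) * (\<Sum>n<N. (\<i> * (h * x)) ^ n /\<^sub>R fact n)" for N x
    unfolding S_def sum_distrib_left
    by (intro sum.cong refl)
       (simp add: scaleR_conv_of_real power_add power_mult_distrib divide_inverse algebra_simps)
  have "(\<lambda>N. CLINT x|M. S N x) \<longlonglongrightarrow> (CLINT x|M. of_real (x ^ m) * iexp ((t + h) * x))"
  proof (rule integral_dominated_convergence[where w = "\<lambda>x. fact m * (2 / d) ^ m * exp (d * x)"])
    show "integrable M (\<lambda>x. fact m * (2 / d) ^ m * exp (d * x))"
      using int by simp
    show "AE x in M. (\<lambda>N. S N x) \<longlonglongrightarrow> of_real (x ^ m) * iexp ((t + h) * x)"
    proof (rule AE_I2)
      fix x
      have "(\<lambda>n. (\<i> * (h * x)) ^ n /\<^sub>R fact n) sums exp (\<i> * (h * x))"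
        by (rule exp_converges)
      then have "(\<lambda>N. S N x) \<longlonglongrightarrow> of_real (x ^ m) * iexp (t * x) * exp (\<i> * (h * x))"
        unfolding S sums_def by (intro tendsto_intros)
      also have "of_real (x ^ m) * iexp (t * x) * exp (\<i> * (h * x)) = of_real (x ^ m) * iexp ((t + h) * x)"
        by (simp add: algebra_simps flip: exp_add)
      finally show "(\<lambda>N. S N x) \<longlonglongrightarrow> of_real (x ^ m) * iexp ((t + h) * x)" .
    qed
    show "AE x in M. norm (S N x) \<le> fact m * (2 / d) ^ m * exp (d * x)" for N
      using nn
    proof eventually_elim
      case (elim x)
      have "norm (\<Sum>n<N. (\<i> * (h * x)) ^ n /\<^sub>R fact n) \<le> (\<Sum>n<N. norm ((\<i> * (h * x)) ^ n /\<^sub>R fact n))"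
        by (rule norm_sum)
      also have "\<dots> = (\<Sum>n<N. (\<bar>h\<bar> * x) ^ n /\<^sub>R fact n)"
        using elim by (simp add: norm_power norm_mult abs_mult)
      also have "\<dots> \<le> (\<Sum>n. (\<bar>h\<bar> * x) ^ n /\<^sub>R fact n)"
        using elim by (intro sum_le_suminf summable_exp_generic) auto
      also have "\<dots> = exp (\<bar>h\<bar> * x)" by (simp add: exp_def)
      also have "\<dots> \<le> exp (d / 2 * x)" using mult_right_mono[OF h elim] by simp
      finally have "norm (S N x) \<le> x ^ m * exp (d / 2 * x)"
        unfolding S using elim by (simp add: norm_mult norm_power mult_left_mono)
      then show ?case using power_times_exp_le[OF elim d, of m] by linarith
    qed
  qed (auto simp: S_def)
  moreover have "(CLINT x|M. S N x) = (\<Sum>n<N. (\<i> * h) ^ n / fact n * (CLINT x|M. of_real (x ^ (m + n)) * iexp (t * x)))" for N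
    unfolding S_def
    by (subst Bochner_Integration.integral_sum)
       (simp_all only: integral_mult_right_zero integrable_mult_right integrable_power_iexp[OF d int nn])
  ultimately show ?thesis unfolding sums_def by simp
qed

text \<open>The characteristic functions agree near 0 by their power series. Comparing the transforms of
  all the measures \<open>x ^ m dM\<close> at once lets the agreement propagate in steps of length \<open>d / 2\<close>.\<close>

lemma moment_determinacy:
  fixes M N :: "real measure"
  assumes "real_distribution M" "real_distribution N" and d: "0 < d"
    and nn: "AE x in M. 0 \<le> x" "AE x in N. 0 \<le> x"
    and int: "integrable M (\<lambda>x. exp (d * x))" "integrable N (\<lambda>x. exp (d * x))"
    and mom: "\<And>n. (LINT x|M. x ^ n) = (LINT x|N. x ^ n)"
  shows "M = N"
proof -
  interpret M: real_distribution M by fact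
  interpret N: real_distribution N by fact
  define A B where "A m t = (CLINT x|M. of_real (x ^ m) * iexp (t * x))"
    and "B m t = (CLINT x|N. of_real (x ^ m) * iexp (t * x))" for m t
  have step: "\<forall>m. A m (t + h) = B m (t + h)" if "\<forall>m. A m t = B m t" "\<bar>h\<bar> \<le> d / 2" for t h
  proof
    fix m
    have "(\<lambda>n. (\<i> * h) ^ n / fact n * A (m + n) t) sums A m (t + h)"
      unfolding A_def using M.power_iexp_shift_sums[OF d int(1) nn(1) that(2)] by simp
    moreover have "(\<lambda>n. (\<i> * h) ^ n / fact n * B (m + n) t) sums B m (t + h)"
      unfolding B_def using N.power_iexp_shift_sums[OF d int(2) nn(2) that(2)] by simp
    ultimately show "A m (t + h) = B m (t + h)"
      using that(1) sums_unique2 by simp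
  qed
  have zero: "A m 0 = B m 0" for m
    unfolding A_def B_def using mom[of m] by (simp del: of_real_power)
  have scaled: "\<forall>m. A m (real k * h) = B m (real k * h)" if "\<bar>h\<bar> \<le> d / 2" for k h
  proof (induction k)
    case (Suc k)
    then show ?case using step[OF Suc that] by (simp add: algebra_simps)
  qed (use zero in simp)
  have "\<exists>k h. t = real k * h \<and> \<bar>h\<bar> \<le> d / 2" for t
  proof -
    obtain k :: nat where k: "2 * \<bar>t\<bar> / d < real k" using reals_Archimedean2 by blast
    moreover have "0 \<le> 2 * \<bar>t\<bar> / d" using d by simp
    ultimately have "0 < real k" by linarith
    then show ?thesis using d k
      by (intro exI[of _ k] exI[of _ "t / real k"]) (auto simp: abs_divide field_simps)
  qed
  with scaled have "A 0 t = B 0 t" for t by metis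
  then have "char M = char N" by (simp add: fun_eq_iff char_def A_def B_def)
  then show ?thesis by (rule Levy_uniqueness[OF assms(1,2)])
qed

text \<open>The map \<open>exp (- x)\<close> turns Laplace transforms at natural numbers into
  moments of laws carried by the interval from 0 to 1. Such laws have exponential moments, so
  \<open>moment_determinacy\<close> applies with \<open>d = 1\<close>, and \<open>- ln z\<close>
  undoes the map.\<close>

lemma Laplace_uniqueness:
  fixes M N :: "real measure"
  assumes "real_distribution M" "real_distribution N"
    and nn: "AE x in M. 0 \<le> x" "AE x in N. 0 \<le> x"
    and lap: "\<And>n. (LINT x|M. exp (- real n * x)) = (LINT x|N. exp (- real n * x))"
  shows "M = N"
proof -
  interpret M: real_distribution M by fact
  interpret N: real_distribution N by fact
  let ?e = "\<lambda>x::real. exp (- x)"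
  have aux: "integrable (distr P borel ?e) (\<lambda>x. exp (1 * x))" "AE x in distr P borel ?e. 0 \<le> x"
    "(LINT x|distr P borel ?e. x ^ n) = (LINT x|P. exp (- real n * x))"
    "distr (distr P borel ?e) borel (\<lambda>z. - ln z) = P" "real_distribution (distr P borel ?e)"
    if "real_distribution P" "AE x in P. 0 \<le> x" for P n
  proof -
    interpret P: real_distribution P by fact
    show "real_distribution (distr P borel ?e)"
      by (rule P.real_distribution_distr) simp
    show "AE x in distr P borel ?e. 0 \<le> x" by (subst AE_distr_iff) auto
    show "(LINT x|distr P borel ?e. x ^ n) = (LINT x|P. exp (- real n * x))"
      by (subst integral_distr) (auto simp: exp_of_nat_mult[symmetric])
    show "distr (distr P borel ?e) borel (\<lambda>z. - ln z) = P"
      by (subst distr_distr) (auto simp: comp_def intro!: distr_id2)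
    show "integrable (distr P borel ?e) (\<lambda>x. exp (1 * x))"
    proof (subst integrable_distr_eq)
      show "integrable P (\<lambda>x. exp (1 * exp (- x)))"
        using that(2) by (intro P.integrable_const_bound[where B = "exp 1"]) auto
    qed auto
  qed
  note M = aux[OF assms(1) nn(1)] and N = aux[OF assms(2) nn(2)]
  have "(LINT x|distr M borel ?e. x ^ n) = (LINT x|distr N borel ?e. x ^ n)" for n
    by (simp only: M(3) N(3) lap)
  then have "distr M borel ?e = distr N borel ?e"
    by (intro moment_determinacy[OF M(5) N(5) zero_less_one M(2) N(2) M(1) N(1)])
  then show ?thesis using M(4) N(4) by metis
qed

text \<open>Integrate the exponential series term by term: since \<open>f\<close> is nonnegative,
  the assumed moment series is the series of L1 norms.\<close>

lemma integrable_exp_of_moments: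
  assumes nn: "AE x in M. 0 \<le> (f x :: real)" and int: "\<And>n. integrable M (\<lambda>x. f x ^ n)"
    and sum: "summable (\<lambda>n. (LINT x|M. f x ^ n) * d ^ n / fact n)" and d: "0 \<le> d"
  shows "integrable M (\<lambda>x. exp (d * f x))"
proof -
  have "integrable M (\<lambda>x. \<Sum>n. (d * f x) ^ n /\<^sub>R fact n)"
  proof (rule integrable_suminf)
    show "integrable M (\<lambda>x. (d * f x) ^ n /\<^sub>R fact n)" for n
      using int by (simp add: power_mult_distrib)
    show "AE x in M. summable (\<lambda>n. norm ((d * f x) ^ n /\<^sub>R fact n))"
      by (intro AE_I2 summable_norm_exp)
    have [measurable]: "f \<in> borel_measurable M"
      using int[of 1, THEN borel_measurable_integrable] by simp
    have "(LINT x|M. norm ((d * f x) ^ n /\<^sub>R fact n)) = (LINT x|M. f x ^ n * (d ^ n / fact n))" for n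
    proof (intro integral_cong_AE)
      show "AE x in M. norm ((d * f x) ^ n /\<^sub>R fact n) = f x ^ n * (d ^ n / fact n)"
        using nn by eventually_elim (use d in \<open>simp add: power_mult_distrib divide_inverse abs_mult power_abs\<close>)
    qed auto
    then show "summable (\<lambda>n. LINT x|M. norm ((d * f x) ^ n /\<^sub>R fact n))"
      using sum by simp
  qed
  then show ?thesis by (simp add: exp_def)
qed

section \<open>Weighted Laplace transforms: integrability and differentiation\<close>

text \<open>Half of the rate absorbs \<open>x ^ k\<close>; \<open>int\<close> at
  \<open>t / 2\<close> takes care of what remains.\<close>

lemma Laplace_integrable_power:
  fixes w :: "real \<Rightarrow> real"
  assumes int: "\<And>t. 0 < t \<Longrightarrow> integrable M (\<lambda>x. w x * exp (- t * x))"
    and nn: "AE x in M. 0 \<le> x" and [measurable_cong]: "sets M = sets borel" and t: "0 < t"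
  shows "integrable M (\<lambda>x. x ^ k * w x * exp (- t * x))"
proof (rule Bochner_Integration.integrable_bound)
  \<comment> \<open>Measurability of \<open>w\<close> is recovered from integrability by multiplying
    the exponential away.\<close>
  have "(\<lambda>x. w x * exp (- t * x) * exp (t * x)) \<in> borel_measurable M"
    using int[OF t, THEN borel_measurable_integrable] by measurable
  then have [measurable]: "w \<in> borel_measurable M"
    by (simp add: mult.assoc flip: exp_add)
  show "(\<lambda>x. x ^ k * w x * exp (- t * x)) \<in> borel_measurable M"
    by measurable
  show "integrable M (\<lambda>x. fact k * (2 / t) ^ k * (w x * exp (- (t / 2) * x)))"
    using t by (intro integrable_mult_right int) auto
  show "AE x in M. norm (x ^ k * w x * exp (- t * x)) \<le> norm (fact k * (2 / t) ^ k * (w x * exp (- (t / 2) * x)))"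
    using nn
  proof eventually_elim
    case (elim x)
    have "x ^ k * exp (t / 2 * x) * exp (- ((t / 2 + t) * x)) \<le> fact k * (2 / t) ^ k * exp (t * x) * exp (- ((t / 2 + t) * x))"
      by (intro mult_right_mono power_times_exp_le elim t) auto
    then have "x ^ k * exp (- t * x) \<le> fact k * (2 / t) ^ k * exp (- (t / 2) * x)"
      by (simp add: mult.assoc distrib_right flip: exp_add)
    then have "\<bar>w x\<bar> * (x ^ k * exp (- t * x)) \<le> \<bar>w x\<bar> * (fact k * (2 / t) ^ k * exp (- (t / 2) * x))"
      by (intro mult_left_mono) auto
    then show ?case using elim t by (simp add: abs_mult power_abs mult_ac)
  qed
qed

lemma exp_taylor1_bound: "\<bar>exp y - 1 - y\<bar> \<le> exp \<bar>y\<bar> * y\<^sup>2" for y :: real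
  using Taylor_exp_field[of y 1] by (simp add: algebra_simps power2_eq_square)

text \<open>Expanding \<open>exp (- h * x)\<close> to first order leaves an error of at most
  \<open>h\<^sup>2 * K\<close>. For \<open>\<bar>h\<bar> < t / 2\<close> the factor
  \<open>exp \<bar>- h * x\<bar>\<close> of the remainder uses up only half of the rate
  \<open>t\<close>, and the other half still makes \<open>x ^ 2 * w x\<close> integrable.\<close>

lemma Laplace_has_real_derivative:
  fixes w :: "real \<Rightarrow> real"
  assumes int: "\<And>t. 0 < t \<Longrightarrow> integrable M (\<lambda>x. w x * exp (- t * x))"
    and nn: "AE x in M. 0 \<le> x" and sets: "sets M = sets borel" and t: "0 < t"
  shows "((\<lambda>t. LINT x|M. w x * exp (- t * x)) has_real_derivative - (LINT x|M. x * w x * exp (- t * x))) (at t)"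
proof -
  define L where "L = (\<lambda>t. LINT x|M. w x * exp (- t * x))"
  define D where "D = (LINT x|M. x * w x * exp (- t * x))"
  define K where "K = (LINT x|M. \<bar>x ^ 2 * w x * exp (- (t / 2) * x)\<bar>)"
  note intk = Laplace_integrable_power[OF int nn sets]
  have bound: "\<bar>L (t + h) - L t + h * D\<bar> \<le> h\<^sup>2 * K" if h: "\<bar>h\<bar> < t / 2" for h
  proof -
    have th: "0 < t + h" using h by linarith
    have i: "integrable M (\<lambda>x. w x * exp (- (t + h) * x))" "integrable M (\<lambda>x. w x * exp (- t * x))"
      "integrable M (\<lambda>x. x * w x * exp (- t * x))"
      using int[OF th] int[OF t] intk[OF _ t, of 1] by simp_all
    have eq: "L (t + h) - L t + h * D =
        (LINT x|M. w x * exp (- (t + h) * x) - w x * exp (- t * x) + h * (x * w x * exp (- t * x)))"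
      unfolding L_def D_def using i by simp
    have "\<bar>L (t + h) - L t + h * D\<bar> \<le> (LINT x|M. \<bar>w x * exp (- (t + h) * x) - w x * exp (- t * x) + h * (x * w x * exp (- t * x))\<bar>)"
      unfolding eq by (rule integral_abs_bound)
    also have "\<dots> \<le> (LINT x|M. h\<^sup>2 * \<bar>x ^ 2 * w x * exp (- (t / 2) * x)\<bar>)"
    proof (rule integral_mono_AE)
      show "integrable M (\<lambda>x. \<bar>w x * exp (- (t + h) * x) - w x * exp (- t * x) + h * (x * w x * exp (- t * x))\<bar>)"
        by (rule integrable_abs[OF Bochner_Integration.integrable_add[OF
              Bochner_Integration.integrable_diff[OF i(1,2)] integrable_mult_right[OF i(3)]]])
      show "integrable M (\<lambda>x. h\<^sup>2 * \<bar>x ^ 2 * w x * exp (- (t / 2) * x)\<bar>)"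
        by (intro integrable_mult_right[OF integrable_abs[OF intk]] half_gt_zero t)
      show "AE x in M. \<bar>w x * exp (- (t + h) * x) - w x * exp (- t * x) + h * (x * w x * exp (- t * x))\<bar>
          \<le> h\<^sup>2 * \<bar>x ^ 2 * w x * exp (- (t / 2) * x)\<bar>"
        using nn
      proof eventually_elim
        case (elim x)
        have "exp (- (t + h) * x) = exp (- t * x) * exp (- h * x)"
          by (simp add: algebra_simps flip: exp_add)
        then have "\<bar>w x * exp (- (t + h) * x) - w x * exp (- t * x) + h * (x * w x * exp (- t * x))\<bar> =
            \<bar>w x * exp (- t * x) * (exp (- h * x) - 1 - (- h * x))\<bar>"
          by (simp add: algebra_simps)
        also have "\<dots> \<le> \<bar>w x\<bar> * exp (- t * x) * (exp \<bar>- h * x\<bar> * (- h * x)\<^sup>2)"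
          unfolding abs_mult[of "w x * exp (- t * x)"] abs_mult[of "w x"] abs_exp_cancel
          by (intro mult_left_mono exp_taylor1_bound) auto
        also have "\<dots> \<le> \<bar>w x\<bar> * exp (- t * x) * (exp (t / 2 * x) * (- h * x)\<^sup>2)"
          using mult_right_mono[of "\<bar>h\<bar>" "t / 2" x] h elim
          by (intro mult_left_mono mult_right_mono) (auto simp: abs_mult)
        also have "\<dots> = h\<^sup>2 * \<bar>x\<^sup>2 * w x\<bar> * (exp (- t * x) * exp (t / 2 * x))"
          by (simp add: abs_mult power_mult_distrib)
        also have "exp (- t * x) * exp (t / 2 * x) = exp (- (t / 2) * x)"
          by (simp add: field_simps flip: exp_add)
        finally show ?case by (simp add: abs_mult)
      qed
    qed
    finally show ?thesis unfolding K_def by simp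
  qed
  have "((\<lambda>h. (L (t + h) - L t) / h - - D) \<longlongrightarrow> 0) (at 0)"
  proof (rule Lim_null_comparison)
    have "\<forall>\<^sub>F h in at 0. \<bar>h\<bar> < t / 2 \<and> h \<noteq> 0"
      using t by (auto simp: eventually_at intro!: exI[of _ "t / 2"])
    then show "\<forall>\<^sub>F h in at 0. norm ((L (t + h) - L t) / h - - D) \<le> \<bar>h\<bar> * K"
    proof eventually_elim
      case (elim h)
      have "norm ((L (t + h) - L t) / h - - D) = norm ((L (t + h) - L t + h * D) / h)"
        using elim by (simp add: field_simps)
      also have "\<dots> \<le> h\<^sup>2 * K / \<bar>h\<bar>"
        using bound[of h] elim by (simp add: divide_right_mono)
      also have "\<dots> = \<bar>h\<bar> * K"
      proof -
        have "h\<^sup>2 = \<bar>h\<bar> * \<bar>h\<bar>" by (simp add: power2_eq_square)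
        then show ?thesis using elim by (simp only: mult.assoc) simp
      qed
      finally show ?case .
    qed
    show "((\<lambda>h. \<bar>h\<bar> * K) \<longlongrightarrow> 0) (at 0)"
      by (auto intro!: tendsto_eq_intros)
  qed
  then have "((\<lambda>h. (L (t + h) - L t) / h) \<longlongrightarrow> - D) (at 0)"
    by (subst Lim_null)
  then show ?thesis unfolding L_def D_def DERIV_def .
qed

section \<open>Gamma and Kummer laws\<close>

text \<open>Euler's integral for \<open>Gamma c\<close>, rescaled by the factor \<open>l\<close>.
  Working with nonnegative integrals yields integrability together with the value.\<close>

lemma has_bochner_integral_gamma_kernel:
  assumes c: "0 < c" and l: "0 < l"
  shows "has_bochner_integral lborel (gamma_kernel c l) (Gamma c / l powr c)"
proof (rule has_bochner_integral_nn_integral)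
  show "gamma_kernel c l \<in> borel_measurable lborel"
    unfolding gamma_kernel_def by measurable
  show "AE x in lborel. 0 \<le> gamma_kernel c l x"
    by (simp add: gamma_kernel_def)
  show "0 \<le> Gamma c / l powr c" using c by (simp add: Gamma_real_nonneg)
  have "ennreal (Gamma c) = (\<integral>\<^sup>+t. ennreal (indicator {0..} t * t powr (c - 1) / exp t) \<partial>lborel)"
    by (rule Gamma_conv_nn_integral_real[OF c])
  also have "\<dots> = l * (\<integral>\<^sup>+t. ennreal (indicator {0..} (0 + l * t) * (0 + l * t) powr (c - 1) / exp (0 + l * t)) \<partial>lborel)"
    using l by (subst nn_integral_real_affine[where c = l and t = 0]) auto
  also have "(\<integral>\<^sup>+t. ennreal (indicator {0..} (0 + l * t) * (0 + l * t) powr (c - 1) / exp (0 + l * t)) \<partial>lborel)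
     = (\<integral>\<^sup>+t. ennreal (l powr (c - 1)) * ennreal (gamma_kernel c l t) \<partial>lborel)"
  proof (rule nn_integral_cong_AE)
    \<comment> \<open>The indicators of \<open>{0..}\<close> and \<open>{0<..}\<close> differ only
      at this point.\<close>
    have "AE t in lborel. t \<noteq> (0::real)" by (rule AE_lborel_singleton)
    then show "AE t in lborel. ennreal (indicator {0..} (0 + l * t) * (0 + l * t) powr (c - 1) / exp (0 + l * t)) =
        ennreal (l powr (c - 1)) * ennreal (gamma_kernel c l t)"
    proof eventually_elim
      case (elim t)
      then show ?case using l
        by (cases "0 < t") (auto simp: gamma_kernel_def indicator_def powr_mult exp_minus divide_inverse zero_le_mult_iff
             simp flip: ennreal_mult')
    qed
  qed
  also have "\<dots> = ennreal (l powr (c - 1)) * (\<integral>\<^sup>+t. ennreal (gamma_kernel c l t) \<partial>lborel)"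
    by (rule nn_integral_cmult) (auto simp: gamma_kernel_def)
  also have "ennreal l * (ennreal (l powr (c - 1)) * (\<integral>\<^sup>+t. ennreal (gamma_kernel c l t) \<partial>lborel)) =
      ennreal (l powr c) * (\<integral>\<^sup>+t. ennreal (gamma_kernel c l t) \<partial>lborel)"
    using l by (simp add: powr_diff mult.assoc[symmetric] flip: ennreal_mult)
  finally have "ennreal (1 / l powr c) * ennreal (Gamma c) =
      ennreal (1 / l powr c) * (ennreal (l powr c) * (\<integral>\<^sup>+t. ennreal (gamma_kernel c l t) \<partial>lborel))"
    by simp
  then show "(\<integral>\<^sup>+t. ennreal (gamma_kernel c l t) \<partial>lborel) = ennreal (Gamma c / l powr c)"
    using l c by (simp add: mult.assoc[symmetric] Gamma_real_nonneg flip: ennreal_mult)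
qed

definition gamma_law :: "real \<Rightarrow> real \<Rightarrow> real measure" where
  "gamma_law c l = density lborel (\<lambda>y. ennreal (l powr c / Gamma c * gamma_kernel c l y))"

lemma gamma_kernel_measurable [measurable]: "gamma_kernel c l \<in> borel_measurable borel"
  unfolding gamma_kernel_def by measurable

lemma gamma_kernel_nonneg [simp]: "0 \<le> gamma_kernel c l y"
  by (simp add: gamma_kernel_def)

text \<open>Powers raise the shape of a gamma kernel and exponentials shift its rate. One rule for
  functions that carry one kernel to another therefore gives moments, exponential moments and
  Laplace transforms alike.\<close>

lemma has_bochner_integral_gamma_law:
  assumes c: "0 < c" and l: "0 < l" and c': "0 < c'" and l': "0 < l'"
    and f: "\<And>y. f y * gamma_kernel c l y = gamma_kernel c' l' y" and [measurable]: "f \<in> borel_measurable borel"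
  shows "integrable (gamma_law c l) f"
    and "(LINT y|gamma_law c l. f y) = (l powr c / Gamma c) * (Gamma c' / l' powr c')"
proof -
  have eq: "(l powr c / Gamma c * gamma_kernel c l y) *\<^sub>R f y = l powr c / Gamma c * gamma_kernel c' l' y" for y
    by (simp add: mult.assoc mult.commute[of _ "f y"] flip: f)
  have pos: "0 \<le> l powr c / Gamma c * gamma_kernel c l y" for y
    using c by (simp add: Gamma_real_nonneg)
  note hb = has_bochner_integral_gamma_kernel[OF c' l', THEN has_bochner_integral_mult_right, of "l powr c / Gamma c"]
  show "integrable (gamma_law c l) f"
    unfolding gamma_law_def using pos hb
    by (subst integrable_density) (simp_all only: eq has_bochner_integral_iff AE_I2, measurable)
  show "(LINT y|gamma_law c l. f y) = (l powr c / Gamma c) * (Gamma c' / l' powr c')"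
    unfolding gamma_law_def using pos hb
    by (subst integral_density) (simp_all only: eq has_bochner_integral_iff AE_I2, measurable)
qed

lemma real_distribution_gamma_law:
  assumes c: "0 < c" and l: "0 < l"
  shows "real_distribution (gamma_law c l)"
proof -
  have pos: "0 < Gamma c" "0 < l powr c" using c l by auto
  have "emeasure (gamma_law c l) (space (gamma_law c l)) =
      (\<integral>\<^sup>+y. ennreal (l powr c / Gamma c) * ennreal (gamma_kernel c l y) \<partial>lborel)"
    unfolding gamma_law_def using pos
    by (subst emeasure_density) (auto simp flip: ennreal_mult intro!: nn_integral_cong)
  also have "\<dots> = ennreal (l powr c / Gamma c) * ennreal (Gamma c / l powr c)"
    using has_bochner_integral_gamma_kernel[OF c l] pos
    by (subst nn_integral_cmult) (auto simp: nn_integral_eq_integral has_bochner_integral_iff)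
  also have "\<dots> = 1" using pos by (simp flip: ennreal_mult)
  finally have "prob_space (gamma_law c l)" by (rule prob_spaceI)
  then show ?thesis
    by (simp add: real_distribution_def real_distribution_axioms_def gamma_law_def)
qed

lemma AE_gamma_law: "AE y in gamma_law c l. 0 < y"
  unfolding gamma_law_def by (subst AE_density) (auto simp: gamma_kernel_def indicator_def)

lemma gamma_law_moment:
  assumes c: "0 < c" and l: "0 < l"
  shows "(LINT y|gamma_law c l. y ^ n) = pochhammer c n / l ^ n"
proof -
  have "y ^ n * gamma_kernel c l y = gamma_kernel (c + n) l y" for y
    by (auto simp: gamma_kernel_def indicator_def powr_add powr_diff powr_realpow field_simps)
  then have "(LINT y|gamma_law c l. y ^ n) = (l powr c / Gamma c) * (Gamma (c + n) / l powr (c + n))"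
    using c l by (intro has_bochner_integral_gamma_law) auto
  also have "Gamma (c + n) = pochhammer c n * Gamma c"
    using c by (subst pochhammer_Gamma) (auto dest: nonpos_Ints_nonpos simp: Gamma_eq_zero_iff)
  also have "l powr (c + n) = l powr c * l ^ n"
    using l by (simp add: powr_add powr_realpow)
  finally show ?thesis using c l Gamma_real_pos[OF c] by simp
qed

text \<open>Moment determinacy needs an exponential moment of \<open>P\<close>. At rate
  \<open>l / 2\<close> the moment series is the binomial series of \<open>(1 + z) powr (- c)\<close>
  at \<open>z = - 1 / 2\<close>, which converges.\<close>

lemma eq_gamma_lawI_moments:
  assumes "real_distribution P" and nn: "AE y in P. 0 \<le> y" and c: "0 < c" and l: "0 < l"
    and int: "\<And>n. integrable P (\<lambda>y. y ^ n)" and mom: "\<And>n. (LINT y|P. y ^ n) = pochhammer c n / l ^ n"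
  shows "P = gamma_law c l"
proof (rule moment_determinacy)
  have "summable (\<lambda>n. (- c gchoose n) * (- 1 / 2) ^ n)"
    by (rule sums_summable[OF gen_binomial_real]) auto
  moreover have "(- c gchoose n) * (- 1 / 2) ^ n = pochhammer c n / l ^ n * (l / 2) ^ n / fact n" for n
  proof -
    have "(- c gchoose n) * (- 1 / 2) ^ n = pochhammer c n / fact n * ((- 1) ^ n * (- 1 / 2) ^ n)"
      by (simp add: gbinomial_pochhammer)
    also have "(- 1) ^ n * (- 1 / 2) ^ n = (1 / 2 :: real) ^ n"
      by (simp flip: power_mult_distrib)
    finally show ?thesis using l by (simp add: power_divide)
  qed
  ultimately have "summable (\<lambda>n. (LINT y|P. y ^ n) * (l / 2) ^ n / fact n)"
    by (simp add: mom)
  then show "integrable P (\<lambda>y. exp (l / 2 * y))"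
    using l by (intro integrable_exp_of_moments nn int) auto
  have "exp (l / 2 * y) * gamma_kernel c l y = gamma_kernel c (l / 2) y" for y
    by (simp add: gamma_kernel_def field_simps flip: exp_add)
  then show "integrable (gamma_law c l) (\<lambda>y. exp (l / 2 * y))"
    using c l by (intro has_bochner_integral_gamma_law) auto
  show "AE y in gamma_law c l. 0 \<le> y"
    using AE_gamma_law[of c l] by eventually_elim simp
  show "(LINT y|P. y ^ n) = (LINT y|gamma_law c l. y ^ n)" for n
    by (simp only: mom gamma_law_moment[OF c l])
  show "0 < l / 2" using l by simp
qed (fact assms(1) nn real_distribution_gamma_law[OF c l])+

lemma (in prob_space) integral_pos:
  fixes f :: "'a \<Rightarrow> real"
  assumes "integrable M f" and pos: "AE x in M. 0 < f x"
  shows "0 < (\<integral>x. f x \<partial>M)"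
proof -
  have nn: "AE x in M. 0 \<le> f x" using pos by eventually_elim simp
  have "(\<integral>x. f x \<partial>M) \<noteq> 0"
  proof
    assume "(\<integral>x. f x \<partial>M) = 0"
    then have "AE x in M. f x = 0"
      using integral_nonneg_eq_0_iff_AE[OF assms(1) nn] by simp
    with pos have "AE x in M. False" by eventually_elim simp
    then show False by simp
  qed
  moreover have "0 \<le> (\<integral>x. f x \<partial>M)" by (rule integral_nonneg_AE[OF nn])
  ultimately show ?thesis by simp
qed

text \<open>Tilting \<open>P\<close> by \<open>w x * exp (- x)\<close> and normalising gives a law
  with the Laplace transform of the gamma law of shape \<open>p\<close> and rate
  \<open>l + 1\<close>; undoing the tilt yields the Kummer density. The factor
  \<open>exp (- x)\<close> is included because integrability of the weight is given only at positive
  rates.\<close>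

lemma eq_kummer_lawI_Laplace:
  fixes c p l C :: real
  defines "w \<equiv> \<lambda>x. (1 + x) powr c / x"
  assumes "real_distribution P" and pos: "AE x in P. 0 < x" and p: "0 < p" and l: "0 < l"
    and int: "\<And>t. 0 < t \<Longrightarrow> integrable P (\<lambda>x. w x * exp (- t * x))"
    and lap: "\<And>t. 0 < t \<Longrightarrow> (LINT x|P. w x * exp (- t * x)) = C * (1 + t / l) powr (- p)"
  shows "\<exists>K>0. P = density lborel (\<lambda>x. ennreal (K * kummer_kernel (p + 1) (c - (p + 1)) l x))"
proof -
  interpret real_distribution P by fact
  have [measurable]: "w \<in> borel_measurable borel" unfolding w_def by measurable
  have wpos: "0 < w x" if "0 < x" for x using that by (simp add: w_def)
  define L where "L = (LINT x|P. w x * exp (- 1 * x))"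
  have L: "0 < L"
    unfolding L_def using pos by (intro integral_pos int) (auto elim!: eventually_mono simp: wpos)
  have C: "C * (1 + 1 / l) powr (- p) = L" unfolding L_def using lap[of 1] by simp
  define F where "F x = w x * exp (- 1 * x) / L" for x
  define N where "N = density P (\<lambda>x. ennreal (F x))"
  have [measurable]: "F \<in> borel_measurable borel" unfolding F_def by measurable
  have Fpos: "AE x in P. 0 < F x"
    using pos by eventually_elim (use L in \<open>simp add: F_def wpos\<close>)
  then have Fnn: "AE x in P. 0 \<le> F x" by eventually_elim simp
  have intF: "integrable P F" unfolding F_def using int[of 1] by simp
  have "emeasure N (space N) = (\<integral>\<^sup>+x. ennreal (F x) \<partial>P)"
    unfolding N_def by (subst emeasure_density) (auto intro!: nn_integral_cong)
  also have "\<dots> = ennreal (LINT x|P. F x)"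
    by (rule nn_integral_eq_integral[OF intF Fnn])
  also have "(LINT x|P. F x) = L / L" unfolding F_def L_def by (rule integral_divide_zero)
  also have "ennreal (L / L) = 1" using L by simp
  finally have "prob_space N" by (rule prob_spaceI)
  then have N: "real_distribution N"
    by (intro real_distribution.intro real_distribution_axioms.intro)
       (simp_all add: N_def events_eq_borel)
  have "AE x in N. 0 \<le> x"
    unfolding N_def using pos by (subst AE_density) (auto elim!: eventually_mono)
  have "N = gamma_law p (l + 1)"
  proof (rule Laplace_uniqueness[OF N])
    show "real_distribution (gamma_law p (l + 1))"
      using p l by (intro real_distribution_gamma_law) auto
    show "AE x in N. 0 \<le> x" by fact
    show "AE x in gamma_law p (l + 1). 0 \<le> x"
      using AE_gamma_law by (rule eventually_mono) simp
    fix n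
    have "(LINT x|N. exp (- real n * x)) = (LINT x|P. F x * exp (- real n * x))"
      unfolding N_def using Fnn by (subst integral_density) auto
    also have "\<dots> = (LINT x|P. w x * exp (- (1 + real n) * x) / L)"
      by (intro Bochner_Integration.integral_cong refl)
         (simp add: F_def algebra_simps flip: exp_add)
    also have "\<dots> = C * (1 + (1 + real n) / l) powr (- p) / L"
      using lap[of "1 + real n"] by simp
    \<comment> \<open>The hypothesis at \<open>t = 1\<close> expresses \<open>L\<close> through
      \<open>C\<close>, so \<open>C\<close> cancels; it is nonzero because \<open>L\<close>
      is.\<close>
    also have "\<dots> = (1 + (1 + real n) / l) powr (- p) / (1 + 1 / l) powr (- p)"
      using L unfolding C[symmetric] by (cases "C = 0") simp_all
    also have "\<dots> = ((1 + (1 + real n) / l) / (1 + 1 / l)) powr (- p)"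
      using l by (subst powr_divide) auto
    also have "(1 + (1 + real n) / l) / (1 + 1 / l) = (l + 1 + n) / (l + 1)"
      using l by (simp add: divide_simps)
    also have "\<dots> powr (- p) = (l + 1) powr p / (l + 1 + n) powr p"
      using l by (simp add: powr_divide powr_minus divide_simps)
    finally have "(LINT x|N. exp (- real n * x)) = (l + 1) powr p / (l + 1 + n) powr p" .
    moreover have "(LINT x|gamma_law p (l + 1). exp (- real n * x)) =
        (l + 1) powr p / Gamma p * (Gamma p / (l + 1 + n) powr p)"
    proof (rule has_bochner_integral_gamma_law)
      show "exp (- real n * y) * gamma_kernel p (l + 1) y = gamma_kernel p (l + 1 + n) y" for y
        by (simp add: gamma_kernel_def algebra_simps flip: exp_add)
    qed (use p l in auto)
    ultimately show "(LINT x|N. exp (- real n * x)) = (LINT x|gamma_law p (l + 1). exp (- real n * x))"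
      using Gamma_real_pos[OF p] by simp
  qed
  \<comment> \<open>The tilt is inverted by the density \<open>1 / F\<close>, as \<open>F\<close> is
    positive \<open>P\<close>-almost everywhere.\<close>
  have "P = density P (\<lambda>_. 1)" by (simp add: density_1)
  also have "\<dots> = density P (\<lambda>x. ennreal (F x) * ennreal (1 / F x))"
    using Fpos by (intro density_cong) (auto elim!: eventually_mono simp flip: ennreal_mult)
  also have "\<dots> = density N (\<lambda>x. ennreal (1 / F x))"
    unfolding N_def by (subst density_density_eq) auto
  also have "\<dots> = density (gamma_law p (l + 1)) (\<lambda>x. ennreal (1 / F x))"
    using \<open>N = gamma_law p (l + 1)\<close> by simp
  also have "\<dots> = density lborel (\<lambda>x. ennreal ((l + 1) powr p / Gamma p * gamma_kernel p (l + 1) x) * ennreal (1 / F x))"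
    unfolding gamma_law_def by (subst density_density_eq) auto
  also have "(\<lambda>x. ennreal ((l + 1) powr p / Gamma p * gamma_kernel p (l + 1) x) * ennreal (1 / F x)) =
      (\<lambda>x. ennreal ((l + 1) powr p / Gamma p * L * kummer_kernel (p + 1) (c - (p + 1)) l x))"
  proof
    fix x
    show "ennreal ((l + 1) powr p / Gamma p * gamma_kernel p (l + 1) x) * ennreal (1 / F x) =
      ennreal ((l + 1) powr p / Gamma p * L * kummer_kernel (p + 1) (c - (p + 1)) l x)"
    proof (cases "0 < x")
      case True
      have "exp (- (l + 1) * x) = exp (- l * x) * exp (- x)"
        by (simp add: algebra_simps flip: exp_add)
      \<comment> \<open>Dividing by \<open>F\<close> multiplies by
        \<open>L * x * exp x / (1 + x) powr c\<close>: the rate drops from \<open>l + 1\<close> to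
        \<open>l\<close>, the exponent of \<open>x\<close> rises from \<open>p - 1\<close> to
        \<open>p\<close>, and the exponent in the denominator is
        \<open>c = (p + 1) + (c - (p + 1))\<close>.\<close>
      then have "gamma_kernel p (l + 1) x * (1 / F x) = L * kummer_kernel (p + 1) (c - (p + 1)) l x"
        using True L by (simp add: gamma_kernel_def kummer_kernel_def F_def w_def powr_diff field_simps)
      then have "(l + 1) powr p / Gamma p * gamma_kernel p (l + 1) x * (1 / F x) =
          (l + 1) powr p / Gamma p * L * kummer_kernel (p + 1) (c - (p + 1)) l x"
        by (simp only: mult.assoc)
      moreover have "0 \<le> 1 / F x" using True L wpos by (simp add: F_def less_imp_le)
      ultimately show ?thesis by (simp only: flip: ennreal_mult'')
    qed (simp add: gamma_kernel_def kummer_kernel_def)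
  qed
  finally show ?thesis
    using L p l by (intro exI[of _ "(l + 1) powr p / Gamma p * L"]) (auto intro!: Gamma_real_pos)
qed

section \<open>Analytic tools for identifying the law of \<open>X\<close>\<close>

text \<open>The equation has the integrating factor \<open>(1 + t / l) powr (l / b)\<close>: its
  product with \<open>L\<close> has derivative zero on the positive half-line.\<close>

lemma constant_of_Laplace_ode:
  fixes L D :: "real \<Rightarrow> real"
  assumes L: "\<And>t. 0 < t \<Longrightarrow> (L has_real_derivative - D t) (at t)"
    and ode: "\<And>t. 0 < t \<Longrightarrow> L t = b * (1 + t / l) * D t" and l: "0 < l" and b: "0 < b"
  shows "\<exists>C. \<forall>t>0. L t = C * (1 + t / l) powr (- (l / b))"
proof -
  define p where "p = l / b"
  define G where "G t = L t * (1 + t / l) powr p" for t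
  have "\<exists>C. \<forall>t\<in>{0<..}. G t = C"
  proof (rule has_field_derivative_zero_constant)
    fix t :: real assume "t \<in> {0<..}"
    then have t: "0 < t" "0 < 1 + t / l" using l by (auto intro!: add_pos_pos)
    have "(G has_real_derivative - D t * (1 + t / l) powr p + L t * (p * (1 + t / l) powr (p - 1) * (1 / l))) (at t)"
      unfolding G_def using t l by (auto intro!: derivative_eq_intros L)
    also have "- D t * (1 + t / l) powr p + L t * (p * (1 + t / l) powr (p - 1) * (1 / l)) = 0"
    proof -
      have "L t * (p * (1 + t / l) powr (p - 1) * (1 / l)) = D t * (b * p / l) * ((1 + t / l) * (1 + t / l) powr (p - 1))"
        unfolding ode[OF t(1)] by simp
      also have "b * p / l = 1" using l b by (simp add: p_def)
      also have "(1 + t / l) * (1 + t / l) powr (p - 1) = (1 + t / l) powr p"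
        using t(2) by (simp add: powr_diff)
      finally show ?thesis by simp
    qed
    finally show "(G has_real_derivative 0) (at t within {0<..})"
      by (rule DERIV_subset) simp
  qed simp
  then obtain C where C: "\<And>t. 0 < t \<Longrightarrow> G t = C" by auto
  have "L t = C * (1 + t / l) powr (- p)" if "0 < t" for t
  proof -
    have "0 < 1 + t / l" using that l by (auto intro!: add_pos_pos)
    then show ?thesis using C[OF that] by (simp add: G_def powr_minus field_simps)
  qed
  then show ?thesis unfolding p_def by auto
qed

text \<open>This is \<open>ln z \<le> z - 1\<close> at \<open>z = t / c * (1 + x)\<close>,
  multiplied by \<open>c\<close> and exponentiated. It lets any positive rate \<open>t\<close>
  dominate the power.\<close>

lemma one_plus_powr_le_exp:
  fixes c t x :: real
  assumes "0 < c" "0 < t" "0 \<le> x"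
  shows "(1 + x) powr c \<le> exp (t - c - c * ln (t / c)) * exp (t * x)"
proof -
  have "ln (t / c * (1 + x)) \<le> t / c * (1 + x) - 1"
    using assms by (intro ln_le_minus_one) auto
  then have "ln (t / c) + ln (1 + x) \<le> t / c * (1 + x) - 1"
    using assms by (subst (asm) ln_mult) auto
  then have "c * (ln (t / c) + ln (1 + x)) \<le> c * (t / c * (1 + x) - 1)"
    using assms by (intro mult_left_mono) auto
  also have "\<dots> = t * (1 + x) - c"
    using assms by (simp add: right_diff_distrib)
  finally have "c * ln (1 + x) \<le> t - c - c * ln (t / c) + t * x"
    using assms by (simp add: algebra_simps)
  then show ?thesis using assms by (simp add: powr_def flip: exp_add)
qed

text \<open>The points of \<open>S\<close> where \<open>F\<close> is nonzero form an open set; being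
  null, it is empty.\<close>

lemma AE_zero_imp_zero_on_open:
  fixes F :: "real \<Rightarrow> real"
  assumes "continuous_on S F" "open S" and ae: "AE x in lborel. x \<in> S \<longrightarrow> F x = 0" and "x \<in> S"
  shows "F x = 0"
proof (rule ccontr)
  assume "F x \<noteq> 0"
  let ?T = "S \<inter> F -` (- {0})"
  have "open ?T" using assms by (intro continuous_open_preimage) auto
  moreover have "AE y \<in> ?T in lebesgue. y \<in> {}"
    using AE_completion[OF ae] by eventually_elim auto
  ultimately have "x \<in> {}"
    by (rule mem_closed_if_AE_lebesgue_open[OF _ closed_empty]) (use assms \<open>F x \<noteq> 0\<close> in auto)
  then show False by simp
qed

section \<open>Independence and regression\<close>

text \<open>By Fubini for the joint law, \<open>x * y\<close> is integrable in \<open>y\<close> for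
  almost every value \<open>x\<close> of \<open>A\<close>, and almost every such \<open>x\<close> is
  nonzero, so it can be divided out. Finiteness of the mean of \<open>B\<close> is thus obtained
  rather than assumed.\<close>

lemma (in prob_space) indep_var_integrable_factor:
  fixes A B :: "'a \<Rightarrow> real"
  assumes indep: "indep_var borel A borel B" and int: "integrable M (\<lambda>x. A x * B x)"
    and A: "AE x in M. A x \<noteq> 0"
  shows "integrable M B"
proof -
  have [measurable]: "random_variable borel A" "random_variable borel B"
    using indep_var_rv1[OF indep] indep_var_rv2[OF indep] by auto
  interpret PA: prob_space "distr M borel A" by (rule prob_space_distr) simp
  interpret PB: prob_space "distr M borel B" by (rule prob_space_distr) simp
  interpret pair_sigma_finite "distr M borel A" "distr M borel B" ..
  have "integrable (distr M (borel \<Otimes>\<^sub>M borel) (\<lambda>x. (A x, B x))) (\<lambda>(x, y). x * y)"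
    using int by (subst integrable_distr_eq) auto
  then have "integrable (distr M borel A \<Otimes>\<^sub>M distr M borel B) (\<lambda>(x, y). x * y)"
    using indep indep_var_distribution_eq[of borel A borel B] by simp
  then have "AE x in distr M borel A. integrable (distr M borel B) (\<lambda>y. x * y)"
    using AE_integrable_fst'[of "\<lambda>(x, y). x * y"] by simp
  moreover have "AE x in distr M borel A. x \<noteq> 0"
    using A by (subst AE_distr_iff) auto
  ultimately have "AE x in distr M borel A. integrable (distr M borel B) (\<lambda>y. y)"
    by eventually_elim simp
  then have "integrable (distr M borel B) (\<lambda>y. y)" by simp
  then show ?thesis by (subst (asm) integrable_distr_eq) auto
qed

text \<open>\<open>f (U x)\<close> is measurable for the sigma-algebra of \<open>U\<close> and can
  be pulled out of the conditional expectation. Only the product with \<open>V\<close> has to be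
  integrable; integrability of \<open>f (U x) * a\<close> is a conclusion, and is the source of
  higher moments later.\<close>

lemma (in prob_space) cond_exp_given_const:
  assumes [measurable]: "random_variable borel U" "random_variable borel V" "f \<in> borel_measurable borel"
    and ae: "AE x in M. cond_exp_given M V U x = a"
    and int: "integrable M (\<lambda>x. f (U x) * V x)"
  shows "integrable M (\<lambda>x. f (U x) * a)" and "(\<integral>x. f (U x) * V x \<partial>M) = (\<integral>x. f (U x) * a \<partial>M)"
proof -
  let ?F = "vimage_algebra (space M) U borel"
  have sub: "subalgebra M ?F"
    unfolding subalgebra_def using assms(1) by (simp add: measurable_iff_sets)
  interpret finite_measure_subalgebra M ?F
    by unfold_locales (rule sub)
  have [measurable]: "U \<in> borel_measurable ?F" by (rule measurable_vimage_algebra1) auto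
  have f: "(\<lambda>x. f (U x)) \<in> borel_measurable ?F" by measurable
  have eq: "AE x in M. f (U x) * real_cond_exp M ?F V x = f (U x) * a"
    using ae by eventually_elim (simp add: cond_exp_given_def)
  note ce = real_cond_exp_intg[OF int f assms(2)]
  have [measurable]: "(\<lambda>x. f (U x) * real_cond_exp M ?F V x) \<in> borel_measurable M"
    using ce(1) by (rule borel_measurable_integrable)
  have [measurable]: "(\<lambda>x. f (U x) * a) \<in> borel_measurable M" by measurable
  show "integrable M (\<lambda>x. f (U x) * a)"
    using integrable_cong_AE[OF _ _ eq] ce(1) by simp
  show "(\<integral>x. f (U x) * V x \<partial>M) = (\<integral>x. f (U x) * a \<partial>M)"
    using integral_cong_AE[OF _ _ eq] ce(2) by simp
qed

section \<open>The regression conditions as identities between expectations\<close>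

locale regression_setting = prob_space M for M :: "'a measure" +
  fixes X Y :: "'a \<Rightarrow> real" and \<alpha> \<beta> :: real
  assumes indep: "indep_var borel X borel Y"
    and X_pos: "AE \<omega> in M. 0 < X \<omega>" and Y_pos: "AE \<omega> in M. 0 < Y \<omega>"
    and Y_nondegenerate: "nondegenerate M Y"
    and Y_int: "integrable M Y"
    and inverse_X_int: "integrable M (\<lambda>\<omega>. inverse (X \<omega>))"
    and regression: "AE \<omega> in M. cond_exp_given M (\<lambda>\<omega>. X \<omega> * (1 + Y \<omega> / (1 + X \<omega>))) (\<lambda>\<omega>. Y \<omega> / (1 + X \<omega>)) \<omega> = \<alpha>"
    and inverse_regression:
      "AE \<omega> in M. cond_exp_given M (\<lambda>\<omega>. inverse (X \<omega> * (1 + Y \<omega> / (1 + X \<omega>)))) (\<lambda>\<omega>. Y \<omega> / (1 + X \<omega>)) \<omega> = \<beta>"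
begin

definition U :: "'a \<Rightarrow> real" where "U \<omega> = Y \<omega> / (1 + X \<omega>)"

definition f :: "nat \<Rightarrow> real" where "f n = expectation (\<lambda>\<omega>. 1 / (1 + X \<omega>) ^ n)"
definition h :: "nat \<Rightarrow> real" where "h n = expectation (\<lambda>\<omega>. 1 / (X \<omega> * (1 + X \<omega>) ^ n))"
definition g :: "nat \<Rightarrow> real" where "g n = expectation (\<lambda>\<omega>. Y \<omega> ^ n)"

lemma X_measurable [measurable]: "random_variable borel X"
  using indep_var_rv1[OF indep] .

lemma Y_measurable [measurable]: "random_variable borel Y"
  using indep_var_rv2[OF indep] .

lemma U_measurable [measurable]: "random_variable borel U"
  unfolding U_def by measurable

lemma U_pos: "AE \<omega> in M. 0 < U \<omega>"
  using X_pos Y_pos by eventually_elim (simp add: U_def)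

lemma regression_integral:
  assumes "\<phi> \<in> borel_measurable borel" and int: "integrable M (\<lambda>\<omega>. \<phi> (U \<omega>) * (X \<omega> * (1 + U \<omega>)))"
  shows "expectation (\<lambda>\<omega>. \<phi> (U \<omega>) * (X \<omega> * (1 + U \<omega>))) = expectation (\<lambda>\<omega>. \<phi> (U \<omega>) * \<alpha>)"
  by (rule cond_exp_given_const(2)[OF U_measurable _ assms(1) _ int])
     (use regression in \<open>simp_all add: U_def[abs_def]\<close>)

text \<open>Conditioning is tested against \<open>\<phi> u * (1 + u)\<close>, so that the factor
  \<open>1 + U\<close> in \<open>inverse (X * (1 + U))\<close> cancels. What is left on that side
  separates into functions of \<open>X\<close> and of \<open>Y\<close> when \<open>\<phi>\<close> is
  a power.\<close>

lemma inverse_regression_integral: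
  assumes [measurable]: "\<phi> \<in> borel_measurable borel" and int: "integrable M (\<lambda>\<omega>. \<phi> (U \<omega>) / X \<omega>)"
  shows "integrable M (\<lambda>\<omega>. \<phi> (U \<omega>) * (1 + U \<omega>) * \<beta>)"
    and "expectation (\<lambda>\<omega>. \<phi> (U \<omega>) / X \<omega>) = expectation (\<lambda>\<omega>. \<phi> (U \<omega>) * (1 + U \<omega>) * \<beta>)"
proof -
  let ?f = "\<lambda>u. \<phi> u * (1 + u)" and ?V = "\<lambda>\<omega>. inverse (X \<omega> * (1 + U \<omega>))"
  have eq: "AE \<omega> in M. ?f (U \<omega>) * ?V \<omega> = \<phi> (U \<omega>) / X \<omega>"
    using U_pos by eventually_elim (simp add: divide_inverse)
  have "integrable M (\<lambda>\<omega>. ?f (U \<omega>) * ?V \<omega>)"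
    using int by (subst integrable_cong_AE[OF _ _ eq]) auto
  note * = cond_exp_given_const[OF U_measurable _ _ _ this]
  show "integrable M (\<lambda>\<omega>. \<phi> (U \<omega>) * (1 + U \<omega>) * \<beta>)"
    by (rule *(1)) (use inverse_regression in \<open>simp_all add: U_def[abs_def]\<close>)
  have "expectation (\<lambda>\<omega>. \<phi> (U \<omega>) / X \<omega>) = expectation (\<lambda>\<omega>. ?f (U \<omega>) * ?V \<omega>)"
    by (rule integral_cong_AE) (use eq in auto)
  also have "\<dots> = expectation (\<lambda>\<omega>. \<phi> (U \<omega>) * (1 + U \<omega>) * \<beta>)"
    by (rule *(2)) (use inverse_regression in \<open>simp_all add: U_def[abs_def]\<close>)
  finally show "expectation (\<lambda>\<omega>. \<phi> (U \<omega>) / X \<omega>) = expectation (\<lambda>\<omega>. \<phi> (U \<omega>) * (1 + U \<omega>) * \<beta>)" .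
qed

lemma f_int: "integrable M (\<lambda>\<omega>. 1 / (1 + X \<omega>) ^ n)"
proof (rule integrable_const_bound[where B = 1])
  show "AE \<omega> in M. norm (1 / (1 + X \<omega>) ^ n) \<le> 1"
    using X_pos by eventually_elim (simp add: divide_le_eq_1 one_le_power)
qed simp

lemma h_int: "integrable M (\<lambda>\<omega>. 1 / (X \<omega> * (1 + X \<omega>) ^ n))"
proof (rule Bochner_Integration.integrable_bound[OF inverse_X_int])
  show "AE \<omega> in M. norm (1 / (X \<omega> * (1 + X \<omega>) ^ n)) \<le> norm (inverse (X \<omega>))"
    using X_pos
  proof eventually_elim
    case (elim \<omega>)
    then have "1 \<le> (1 + X \<omega>) ^ n" by (intro one_le_power) simp
    then have "1 / X \<omega> / (1 + X \<omega>) ^ n \<le> 1 / X \<omega> / 1"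
      using elim by (intro divide_left_mono) auto
    then show ?case using elim by (simp add: divide_inverse)
  qed
qed simp

lemma f_pos: "0 < f n"
  unfolding f_def using X_pos by (intro integral_pos f_int) (auto elim!: eventually_mono)

text \<open>The partial fraction \<open>1 / x - 1 / (x * (1 + x)) = 1 / (1 + x)\<close>, divided by
  \<open>(1 + x) ^ n\<close>.\<close>

lemma h_diff: "h n - h (Suc n) = f (Suc n)"
proof -
  have "h n - h (Suc n) = expectation (\<lambda>\<omega>. 1 / (X \<omega> * (1 + X \<omega>) ^ n) - 1 / (X \<omega> * (1 + X \<omega>) ^ Suc n))"
    unfolding h_def using h_int[of n] h_int[of "Suc n"] by (simp del: power_Suc)
  also have "\<dots> = f (Suc n)"
    unfolding f_def
  proof (rule integral_cong_AE)
    show "AE \<omega> in M. 1 / (X \<omega> * (1 + X \<omega>) ^ n) - 1 / (X \<omega> * (1 + X \<omega>) ^ Suc n) = 1 / (1 + X \<omega>) ^ Suc n"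
      using X_pos by eventually_elim (simp add: divide_simps)
  qed auto
  finally show ?thesis .
qed

lemma indep_comp:
  assumes "a \<in> borel_measurable borel" "b \<in> borel_measurable borel"
  shows "indep_var borel (\<lambda>\<omega>. a (X \<omega>)) borel (\<lambda>\<omega>. b (Y \<omega>))"
  using indep_var_compose[OF indep assms] by (simp add: comp_def)

lemma indep_product:
  fixes a b :: "real \<Rightarrow> real"
  assumes "a \<in> borel_measurable borel" "b \<in> borel_measurable borel"
    and "integrable M (\<lambda>\<omega>. a (X \<omega>))" "integrable M (\<lambda>\<omega>. b (Y \<omega>))"
  shows "integrable M (\<lambda>\<omega>. a (X \<omega>) * b (Y \<omega>))"
    and "expectation (\<lambda>\<omega>. a (X \<omega>) * b (Y \<omega>)) = expectation (\<lambda>\<omega>. a (X \<omega>)) * expectation (\<lambda>\<omega>. b (Y \<omega>))"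
  using indep_var_integrable[OF indep_comp] indep_var_lebesgue_integral[OF indep_comp] assms by auto

text \<open>The choice \<open>\<phi> u = 1 / (1 + u)\<close> identifies \<open>\<beta>\<close> with
  the expectation of \<open>1 / (X * (1 + U))\<close>, a positive variable bounded by
  \<open>1 / X\<close>.\<close>

lemma beta_pos: "0 < \<beta>"
proof -
  have "integrable M (\<lambda>\<omega>. 1 / (1 + U \<omega>) / X \<omega>)"
  proof (rule Bochner_Integration.integrable_bound[OF inverse_X_int])
    show "AE \<omega> in M. norm (1 / (1 + U \<omega>) / X \<omega>) \<le> norm (inverse (X \<omega>))"
      using X_pos U_pos
    proof eventually_elim
      case (elim \<omega>)
      then have "1 / (1 + U \<omega>) / X \<omega> \<le> 1 / X \<omega>"
        by (intro divide_right_mono) auto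
      then show ?case using elim by (simp add: divide_inverse)
    qed
  qed measurable
  moreover have "expectation (\<lambda>\<omega>. 1 / (1 + U \<omega>) * (1 + U \<omega>) * \<beta>) = expectation (\<lambda>\<omega>. \<beta>)"
  proof (rule integral_cong_AE)
    show "AE \<omega> in M. 1 / (1 + U \<omega>) * (1 + U \<omega>) * \<beta> = \<beta>"
      using U_pos by eventually_elim simp
  qed measurable
  ultimately have "expectation (\<lambda>\<omega>. 1 / (1 + U \<omega>) / X \<omega>) = \<beta>"
    using inverse_regression_integral(2)[of "\<lambda>u. 1 / (1 + u)"] by (simp add: prob_space)
  moreover have "AE \<omega> in M. 0 < 1 / (1 + U \<omega>) / X \<omega>"
    using X_pos U_pos by eventually_elim simp
  ultimately show ?thesis
    using integral_pos \<open>integrable M (\<lambda>\<omega>. 1 / (1 + U \<omega>) / X \<omega>)\<close> by metis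
qed

section \<open>Moments of \<open>U\<close> and \<open>Y\<close> and their recurrences\<close>

lemma U_power_div_X:
  assumes "integrable M (\<lambda>\<omega>. Y \<omega> ^ n)"
  shows "integrable M (\<lambda>\<omega>. U \<omega> ^ n / X \<omega>)" "expectation (\<lambda>\<omega>. U \<omega> ^ n / X \<omega>) = h n * g n"
proof -
  have eq: "U \<omega> ^ n / X \<omega> = 1 / (X \<omega> * (1 + X \<omega>) ^ n) * Y \<omega> ^ n" for \<omega>
    by (simp add: U_def power_divide)
  show "integrable M (\<lambda>\<omega>. U \<omega> ^ n / X \<omega>)" "expectation (\<lambda>\<omega>. U \<omega> ^ n / X \<omega>) = h n * g n"
    unfolding eq h_def g_def
    using indep_product[of "\<lambda>x. 1 / (x * (1 + x) ^ n)" "\<lambda>y. y ^ n"] h_int assms by simp_all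
qed

lemma U_power:
  assumes "integrable M (\<lambda>\<omega>. Y \<omega> ^ n)"
  shows "integrable M (\<lambda>\<omega>. U \<omega> ^ n)" "expectation (\<lambda>\<omega>. U \<omega> ^ n) = f n * g n"
proof -
  have eq: "U \<omega> ^ n = 1 / (1 + X \<omega>) ^ n * Y \<omega> ^ n" for \<omega>
    by (simp add: U_def power_divide)
  show "integrable M (\<lambda>\<omega>. U \<omega> ^ n)" "expectation (\<lambda>\<omega>. U \<omega> ^ n) = f n * g n"
    unfolding eq f_def g_def
    using indep_product[of "\<lambda>x. 1 / (1 + x) ^ n" "\<lambda>y. y ^ n"] f_int assms by simp_all
qed

text \<open>If \<open>Y ^ n\<close> is integrable, so is \<open>U ^ n / X\<close>, and the second
  regression condition then returns integrability of \<open>U ^ n * (1 + U)\<close>. Subtracting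
  \<open>U ^ n\<close> leaves \<open>U ^ Suc n\<close>, a product of independent factors from which
  \<open>Y ^ Suc n\<close> is extracted.\<close>

lemma Y_moments: "integrable M (\<lambda>\<omega>. Y \<omega> ^ n)"
proof (induction n)
  case (Suc n)
  have "integrable M (\<lambda>\<omega>. U \<omega> ^ n * (1 + U \<omega>) * \<beta>)"
    by (rule inverse_regression_integral(1)) (use U_power_div_X(1)[OF Suc] in auto)
  then have "integrable M (\<lambda>\<omega>. U \<omega> ^ n * (1 + U \<omega>))"
    using beta_pos by simp
  then have "integrable M (\<lambda>\<omega>. U \<omega> ^ n * (1 + U \<omega>) - U \<omega> ^ n)"
    by (rule Bochner_Integration.integrable_diff[OF _ U_power(1)[OF Suc]])
  moreover have "U \<omega> ^ n * (1 + U \<omega>) - U \<omega> ^ n = 1 / (1 + X \<omega>) ^ Suc n * Y \<omega> ^ Suc n" for \<omega>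
  proof -
    have "U \<omega> ^ n * (1 + U \<omega>) - U \<omega> ^ n = U \<omega> ^ Suc n" by (simp add: distrib_left)
    then show ?thesis by (simp add: U_def power_divide del: power_Suc)
  qed
  ultimately have "integrable M (\<lambda>\<omega>. 1 / (1 + X \<omega>) ^ Suc n * Y \<omega> ^ Suc n)"
    by (simp only:)
  moreover have "AE \<omega> in M. 1 / (1 + X \<omega>) ^ Suc n \<noteq> 0"
    using X_pos by eventually_elim simp
  ultimately show ?case
    by (intro indep_var_integrable_factor[OF indep_comp[of "\<lambda>x. 1 / (1 + x) ^ Suc n" "\<lambda>y. y ^ Suc n"]]) auto
qed simp

lemma g_pos: "0 < g n"
  unfolding g_def using Y_pos by (intro integral_pos Y_moments) (auto elim!: eventually_mono)

lemma g_0 [simp]: "g 0 = 1"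
  by (simp add: g_def prob_space)

text \<open>The second regression condition with \<open>\<phi> u = u ^ n\<close>.\<close>

lemma h_recurrence: "h n * g n = \<beta> * (f n * g n + f (Suc n) * g (Suc n))"
proof -
  have "h n * g n = expectation (\<lambda>\<omega>. U \<omega> ^ n * (1 + U \<omega>) * \<beta>)"
    unfolding U_power_div_X(2)[OF Y_moments, symmetric]
    by (rule inverse_regression_integral(2)) (use U_power_div_X(1)[OF Y_moments] in auto)
  also have "\<dots> = expectation (\<lambda>\<omega>. \<beta> * (U \<omega> ^ n + U \<omega> ^ Suc n))"
    by (intro Bochner_Integration.integral_cong refl) (simp add: algebra_simps)
  also have "\<dots> = \<beta> * (f n * g n + f (Suc n) * g (Suc n))"
    using U_power[OF Y_moments, of n] U_power[OF Y_moments, of "Suc n"] by (simp del: power_Suc)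
  finally show ?thesis .
qed

text \<open>The first regression condition tested against \<open>u ^ Suc n\<close>. The exponent is
  at least 1, so that \<open>X / (1 + X) ^ Suc n\<close> is bounded; it equals
  \<open>1 / (1 + X) ^ n - 1 / (1 + X) ^ Suc n\<close>, whence only values of \<open>f\<close>
  appear.\<close>

lemma f_recurrence:
  "(f n - f (Suc n)) * g (Suc n) + (f (Suc n) - f (Suc (Suc n))) * g (Suc (Suc n)) = \<alpha> * (f (Suc n) * g (Suc n))"
proof -
  let ?d = "\<lambda>n x. 1 / (1 + x) ^ n - 1 / (1 + x :: real) ^ Suc n"
  have d: "integrable M (\<lambda>\<omega>. ?d n (X \<omega>) * Y \<omega> ^ Suc n)"
    "expectation (\<lambda>\<omega>. ?d n (X \<omega>) * Y \<omega> ^ Suc n) = (f n - f (Suc n)) * g (Suc n)" for n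
    using indep_product[of "?d n" "\<lambda>y. y ^ Suc n"] f_int[of n] f_int[of "Suc n"] Y_moments[of "Suc n"]
    by (simp_all add: f_def g_def del: power_Suc)
  have eq: "AE \<omega> in M. U \<omega> ^ Suc n * (X \<omega> * (1 + U \<omega>)) = ?d n (X \<omega>) * Y \<omega> ^ Suc n + ?d (Suc n) (X \<omega>) * Y \<omega> ^ Suc (Suc n)"
    using X_pos
  proof eventually_elim
    case (elim \<omega>)
    have d: "?d n (X \<omega>) = X \<omega> / (1 + X \<omega>) ^ Suc n" for n
      using elim by (simp add: divide_simps)
    have "U \<omega> ^ Suc n * (X \<omega> * (1 + U \<omega>)) = X \<omega> * U \<omega> ^ Suc n + X \<omega> * U \<omega> ^ Suc (Suc n)"
      by (simp add: algebra_simps)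
    then show ?case unfolding d by (simp add: U_def power_divide del: power_Suc)
  qed
  have int: "integrable M (\<lambda>\<omega>. U \<omega> ^ Suc n * (X \<omega> * (1 + U \<omega>)))"
    by (subst integrable_cong_AE[OF _ _ eq]) (auto simp del: power_Suc intro!: Bochner_Integration.integrable_add d)
  have "(f n - f (Suc n)) * g (Suc n) + (f (Suc n) - f (Suc (Suc n))) * g (Suc (Suc n)) =
      expectation (\<lambda>\<omega>. ?d n (X \<omega>) * Y \<omega> ^ Suc n + ?d (Suc n) (X \<omega>) * Y \<omega> ^ Suc (Suc n))"
    by (subst Bochner_Integration.integral_add[OF d(1) d(1)]) (simp only: d(2))
  also have "\<dots> = expectation (\<lambda>\<omega>. U \<omega> ^ Suc n * (X \<omega> * (1 + U \<omega>)))"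
    by (rule integral_cong_AE) (use eq in auto)
  also have "\<dots> = expectation (\<lambda>\<omega>. U \<omega> ^ Suc n * \<alpha>)"
    by (rule regression_integral[OF _ int]) measurable
  also have "\<dots> = \<alpha> * (f (Suc n) * g (Suc n))"
    using U_power(2)[OF Y_moments, of "Suc n"] by (simp del: power_Suc)
  finally show ?thesis .
qed

lemma ratio_step: "g (Suc (Suc n)) / g (Suc n) = g (Suc n) / g n + (\<alpha> - 1 / \<beta>)"
proof -
  define r where "r n = g (Suc n) / g n" for n
  have g: "g (Suc n) = r n * g n" for n using g_pos[of n] by (simp add: r_def)
  have h: "h n = \<beta> * (f n + f (Suc n) * r n)" for n
    using h_recurrence[of n] g_pos[of n] unfolding g[of n]
    by (simp add: distrib_left[symmetric] mult.assoc[symmetric] distrib_right[symmetric])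
  have "((f n - f (Suc n)) + (f (Suc n) - f (Suc (Suc n))) * r (Suc n)) * g (Suc n) = (\<alpha> * f (Suc n)) * g (Suc n)"
    using f_recurrence[of n] unfolding g[of "Suc n"] by (simp add: algebra_simps)
  then have f: "f n - f (Suc n) + (f (Suc n) - f (Suc (Suc n))) * r (Suc n) = \<alpha> * f (Suc n)"
    using g_pos[of "Suc n"] by simp
  \<comment> \<open>Inserting \<open>h\<close> at \<open>n\<close> and at \<open>Suc n\<close> into
    \<open>h_diff\<close> eliminates it.\<close>
  have "f (Suc n) = \<beta> * (f n + f (Suc n) * r n - f (Suc n) - f (Suc (Suc n)) * r (Suc n))"
    using h_diff[of n] unfolding h by (simp add: algebra_simps)
  then have "f (Suc n) / \<beta> = f n + f (Suc n) * r n - f (Suc n) - f (Suc (Suc n)) * r (Suc n)"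
    using beta_pos by (simp add: field_simps)
  \<comment> \<open>On subtraction, \<open>f n\<close> and
    \<open>f (Suc (Suc n)) * r (Suc n)\<close> cancel; every remaining term carries the positive
    factor \<open>f (Suc n)\<close>.\<close>
  with f have "f (Suc n) * r (Suc n) = f (Suc n) * (r n + (\<alpha> - 1 / \<beta>))"
    by (simp add: algebra_simps)
  then have "r (Suc n) = r n + (\<alpha> - 1 / \<beta>)"
    using f_pos[of "Suc n"] by (metis less_irrefl mult_left_cancel)
  then show ?thesis unfolding r_def .
qed

text \<open>The variance of the non-degenerate \<open>Y\<close> is strictly positive, so
  \<open>g 1 < g 2 / g 1\<close>; by \<open>ratio_step\<close> at 0 the gap is exactly
  \<open>\<alpha> - 1 / \<beta>\<close>.\<close>

lemma delta_pos: "0 < \<alpha> - 1 / \<beta>"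
proof -
  have sq: "integrable M (\<lambda>\<omega>. (Y \<omega> - g 1)\<^sup>2)"
    using Y_moments[of 2] Y_int by (simp add: power2_diff)
  have nn: "AE \<omega> in M. 0 \<le> (Y \<omega> - g 1)\<^sup>2" by simp
  have "expectation (\<lambda>\<omega>. (Y \<omega> - g 1)\<^sup>2) \<noteq> 0"
  proof
    assume "expectation (\<lambda>\<omega>. (Y \<omega> - g 1)\<^sup>2) = 0"
    then have "AE \<omega> in M. (Y \<omega> - g 1)\<^sup>2 = 0"
      using integral_nonneg_eq_0_iff_AE[OF sq nn] by simp
    then have "AE \<omega> in M. Y \<omega> = g 1" by eventually_elim simp
    then show False using Y_nondegenerate by (auto simp: nondegenerate_def)
  qed
  moreover have "0 \<le> expectation (\<lambda>\<omega>. (Y \<omega> - g 1)\<^sup>2)" by simp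
  moreover have "expectation (\<lambda>\<omega>. (Y \<omega> - g 1)\<^sup>2) = g 2 - g 1 * g 1"
  proof -
    have "expectation (\<lambda>\<omega>. (Y \<omega> - g 1)\<^sup>2) = expectation (\<lambda>\<omega>. Y \<omega> ^ 2 + (g 1)\<^sup>2 - 2 * g 1 * Y \<omega>)"
      by (intro Bochner_Integration.integral_cong refl) (simp add: power2_diff algebra_simps)
    also have "\<dots> = g 2 + (g 1)\<^sup>2 - 2 * g 1 * g 1"
      using Y_moments[of 2] Y_int by (simp add: g_def prob_space)
    finally show ?thesis by (simp add: power2_eq_square)
  qed
  ultimately have "g 1 * g 1 < g 2" by linarith
  then have "g 1 < g 2 / g 1" using g_pos[of 1] by (simp add: field_simps)
  then show ?thesis using ratio_step[of 0] by (simp add: numeral_2_eq_2)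
qed

text \<open>A gamma law of shape \<open>c\<close> and rate \<open>lam\<close> has successive moment
  ratios \<open>(c + n) / lam\<close>. Matching the increment \<open>\<alpha> - 1 / \<beta>\<close>
  with \<open>1 / lam\<close> and the first ratio \<open>g 1\<close> with \<open>c / lam\<close>
  dictates both parameters.\<close>

definition lam :: real where "lam = 1 / (\<alpha> - 1 / \<beta>)"
definition c :: real where "c = lam * g 1"

lemma lam_pos: "0 < lam" unfolding lam_def using delta_pos by simp

lemma c_pos: "0 < c" unfolding c_def using lam_pos g_pos by simp

lemma g_eq: "g n = pochhammer c n / lam ^ n"
proof -
  have r: "g (Suc n) / g n = (c + n) / lam" for n
  proof (induction n)
    case 0
    then show ?case using lam_pos by (simp add: c_def)
  next
    case (Suc n)
    have "\<alpha> - 1 / \<beta> = 1 / lam" by (simp add: lam_def)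
    then show ?case using ratio_step[of n] Suc by (simp add: add_divide_distrib)
  qed
  show ?thesis
  proof (induction n)
    case (Suc n)
    have "g (Suc n) = (c + n) / lam * g n"
      using r[of n] g_pos[of n] by (simp add: field_simps)
    then show ?case using Suc by (simp add: pochhammer_Suc)
  qed simp
qed

lemma distr_Y: "distr M borel Y = gamma_law c lam"
proof (rule eq_gamma_lawI_moments[OF _ _ c_pos lam_pos])
  show "real_distribution (distr M borel Y)" by (rule real_distribution_distr) simp
  show "AE y in distr M borel Y. 0 \<le> y"
    using Y_pos by (subst AE_distr_iff) (auto elim!: eventually_mono)
  show "integrable (distr M borel Y) (\<lambda>y. y ^ n)" for n
    using Y_moments[of n] by (subst integrable_distr_eq) auto
  show "(LINT y|distr M borel Y. y ^ n) = pochhammer c n / lam ^ n" for n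
    unfolding g_eq[symmetric] g_def by (subst integral_distr) auto
qed

section \<open>The law of X\<close>

abbreviation P :: "real measure" where "P \<equiv> distr M borel X"

text \<open>Given \<open>X = x\<close>, \<open>U\<close> has a gamma density of rate
  \<open>lam * (1 + x)\<close>, whose dependence on \<open>x\<close> at \<open>u\<close> is
  \<open>(1 + x) powr c * exp (- lam * u * x)\<close>. Up to a common factor depending on
  \<open>u\<close>, \<open>L (lam * u)\<close> integrates \<open>1 / x\<close> against it and
  \<open>D (lam * u)\<close> integrates 1.\<close>

definition w :: "real \<Rightarrow> real" where "w x = (1 + x) powr c / x"
definition L :: "real \<Rightarrow> real" where "L t = (LINT x|P. w x * exp (- t * x))"
definition D :: "real \<Rightarrow> real" where "D t = (LINT x|P. x * w x * exp (- t * x))"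

text \<open>By \<open>distr_Y\<close>, this is the density of \<open>Y\<close>.\<close>

definition gd :: "real \<Rightarrow> real" where "gd y = lam powr c / Gamma c * gamma_kernel c lam y"

lemma w_measurable [measurable]: "w \<in> borel_measurable borel"
  unfolding w_def by measurable

lemma gd_measurable [measurable]: "gd \<in> borel_measurable borel"
  unfolding gd_def by measurable

lemma gd_nonneg: "0 \<le> gd y"
  using c_pos by (simp add: gd_def Gamma_real_nonneg)

lemma real_distribution_P: "real_distribution P"
  by (rule real_distribution_distr) simp

lemma P_pos: "AE x in P. 0 < x"
  using X_pos by (subst AE_distr_iff) auto

lemma P_nonneg: "AE x in P. 0 \<le> x"
  using P_pos by eventually_elim simp

text \<open>Bounding \<open>(1 + x) powr c\<close> by a multiple of \<open>exp (t * x)\<close>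
  exactly uses up the decay and leaves a multiple of \<open>1 / x\<close>, which
  \<open>inverse_X_int\<close> controls.\<close>

lemma w_int:
  assumes t: "0 < t"
  shows "integrable P (\<lambda>x. w x * exp (- t * x))"
proof (rule Bochner_Integration.integrable_bound)
  let ?K = "exp (t - c - c * ln (t / c))"
  show "integrable P (\<lambda>x. ?K * inverse x)"
    using inverse_X_int by (intro integrable_mult_right) (simp add: integrable_distr_eq)
  show "AE x in P. norm (w x * exp (- t * x)) \<le> norm (?K * inverse x)"
    using P_pos
  proof eventually_elim
    case (elim x)
    have "(1 + x) powr c * (inverse x * exp (- t * x)) \<le> ?K * exp (t * x) * (inverse x * exp (- t * x))"
      using elim by (intro mult_right_mono one_plus_powr_le_exp c_pos t) auto
    also have "\<dots> = ?K * inverse x * (exp (t * x) * exp (- t * x))" by (simp only: mult_ac)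
    also have "exp (t * x) * exp (- t * x) = 1" by (simp flip: exp_add)
    finally show ?case using elim by (simp add: w_def divide_inverse mult.assoc)
  qed
qed measurable

lemma xw_int:
  assumes t: "0 < t"
  shows "integrable P (\<lambda>x. x * w x * exp (- t * x))"
  using Laplace_integrable_power[OF w_int P_nonneg _ t, of 1] by simp

lemma L_deriv:
  assumes "0 < t"
  shows "(L has_real_derivative - D t) (at t)"
  unfolding L_def[abs_def] D_def
  by (rule Laplace_has_real_derivative[OF w_int P_nonneg _ assms]) auto

text \<open>\<open>D\<close> is itself a weighted Laplace transform, with weight
  \<open>x * w x\<close>, and so differentiable.\<close>

lemma D_isCont:
  assumes "0 < t"
  shows "isCont D t"
  unfolding D_def[abs_def]
  by (rule DERIV_isCont, rule Laplace_has_real_derivative[OF xw_int P_nonneg _ assms]) auto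

section \<open>The joint law of \<open>X\<close> and \<open>U\<close> and the differential equation
  for \<open>L\<close>\<close>

text \<open>Substituting \<open>y = (1 + x) * u\<close> for fixed \<open>x\<close> turns the density
  of \<open>Y\<close> into the conditional density of \<open>U\<close>. The integral over
  \<open>u\<close> is moved outside so that the regression condition can be localised at single
  values of \<open>U\<close>.\<close>

lemma nn_integral_X_U:
  assumes [measurable]: "case_prod \<psi> \<in> borel_measurable (borel \<Otimes>\<^sub>M borel)"
  shows "(\<integral>\<^sup>+\<omega>. \<psi> (X \<omega>) (U \<omega>) \<partial>M) =
    (\<integral>\<^sup>+u. (\<integral>\<^sup>+x. \<psi> x u * ennreal ((1 + x) * gd ((1 + x) * u)) \<partial>P) \<partial>lborel)"
proof -
  interpret P: prob_space P by (rule prob_space_distr) simp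
  interpret Q: prob_space "distr M borel Y" by (rule prob_space_distr) simp
  interpret PL: pair_sigma_finite P lborel ..
  have [measurable (raw)]: "(\<lambda>x. \<psi> (f x) (k x)) \<in> borel_measurable N"
    if "f \<in> borel_measurable N" "k \<in> borel_measurable N" for f k and N :: "'z measure"
    using measurable_compose[OF measurable_Pair[OF that] assms] by simp
  have "(\<integral>\<^sup>+\<omega>. \<psi> (X \<omega>) (U \<omega>) \<partial>M) =
      (\<integral>\<^sup>+z. \<psi> (fst z) (snd z / (1 + fst z)) \<partial>distr M (borel \<Otimes>\<^sub>M borel) (\<lambda>\<omega>. (X \<omega>, Y \<omega>)))"
    by (subst nn_integral_distr) (simp_all add: U_def)
  also have "distr M (borel \<Otimes>\<^sub>M borel) (\<lambda>\<omega>. (X \<omega>, Y \<omega>)) = P \<Otimes>\<^sub>M distr M borel Y"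
    using indep indep_var_distribution_eq[of borel X borel Y] by simp
  also have "(\<integral>\<^sup>+z. \<psi> (fst z) (snd z / (1 + fst z)) \<partial>(P \<Otimes>\<^sub>M distr M borel Y)) =
      (\<integral>\<^sup>+x. \<integral>\<^sup>+y. \<psi> x (y / (1 + x)) \<partial>distr M borel Y \<partial>P)"
    by (subst Q.nn_integral_fst[symmetric]) simp_all
  also have "\<dots> = (\<integral>\<^sup>+x. \<integral>\<^sup>+u. \<psi> x u * ennreal ((1 + x) * gd ((1 + x) * u)) \<partial>lborel \<partial>P)"
  proof (rule nn_integral_cong_AE)
    show "AE x in P. (\<integral>\<^sup>+y. \<psi> x (y / (1 + x)) \<partial>distr M borel Y) =
        (\<integral>\<^sup>+u. \<psi> x u * ennreal ((1 + x) * gd ((1 + x) * u)) \<partial>lborel)"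
      using P_pos
    proof eventually_elim
      case (elim x)
      have "(\<integral>\<^sup>+y. \<psi> x (y / (1 + x)) \<partial>distr M borel Y) = (\<integral>\<^sup>+y. ennreal (gd y) * \<psi> x (y / (1 + x)) \<partial>lborel)"
        unfolding distr_Y gamma_law_def by (subst nn_integral_density) (simp_all add: gd_def)
      also have "\<dots> = ennreal \<bar>1 + x\<bar> * (\<integral>\<^sup>+u. ennreal (gd (0 + (1 + x) * u)) * \<psi> x ((0 + (1 + x) * u) / (1 + x)) \<partial>lborel)"
        using elim by (intro nn_integral_real_affine) auto
      also have "\<dots> = (\<integral>\<^sup>+u. ennreal (1 + x) * (ennreal (gd ((1 + x) * u)) * \<psi> x u) \<partial>lborel)"
        using elim by (subst nn_integral_cmult) auto
      also have "\<dots> = (\<integral>\<^sup>+u. \<psi> x u * ennreal ((1 + x) * gd ((1 + x) * u)) \<partial>lborel)"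
        using elim gd_nonneg by (intro nn_integral_cong) (simp add: ennreal_mult mult_ac)
      finally show ?case .
    qed
  qed
  also have "\<dots> = (\<integral>\<^sup>+u. \<integral>\<^sup>+x. \<psi> x u * ennreal ((1 + x) * gd ((1 + x) * u)) \<partial>P \<partial>lborel)"
    by (rule PL.Fubini'[symmetric]) measurable
  finally show ?thesis .
qed

text \<open>Testing the second regression condition against indicators of Borel sets shows that both
  sides are densities of the same finite measure.\<close>

lemma densities_eq:
  "AE u in lborel. (\<integral>\<^sup>+x. ennreal (1 / x) * ennreal ((1 + x) * gd ((1 + x) * u)) \<partial>P) =
     (\<integral>\<^sup>+x. ennreal (\<beta> * (1 + u)) * ennreal ((1 + x) * gd ((1 + x) * u)) \<partial>P)"
    (is "AE u in lborel. ?a u = ?b u")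
proof (rule finite_density_unique[THEN iffD1])
  interpret P: prob_space P by (rule prob_space_distr) simp
  show [measurable]: "?a \<in> borel_measurable lborel" "?b \<in> borel_measurable lborel"
    by measurable
  have a: "(\<integral>\<^sup>+u. ?a u * indicator A u \<partial>lborel) = ennreal (expectation (\<lambda>\<omega>. indicator A (U \<omega>) / X \<omega>))"
    and b: "(\<integral>\<^sup>+u. ?b u * indicator A u \<partial>lborel) = ennreal (expectation (\<lambda>\<omega>. indicator A (U \<omega>) / X \<omega>))"
    if [measurable]: "A \<in> sets borel" for A
  proof -
    have int: "integrable M (\<lambda>\<omega>. indicator A (U \<omega>) / X \<omega>)"
      by (rule Bochner_Integration.integrable_bound[OF inverse_X_int])
         (auto simp: indicator_def divide_inverse)
    have nn: "AE \<omega> in M. 0 \<le> indicator A (U \<omega>) / X \<omega>"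
      using X_pos by eventually_elim simp
    have "(\<integral>\<^sup>+u. ?a u * indicator A u \<partial>lborel) =
        (\<integral>\<^sup>+u. (\<integral>\<^sup>+x. ennreal (1 / x) * indicator A u * ennreal ((1 + x) * gd ((1 + x) * u)) \<partial>P) \<partial>lborel)"
      by (subst nn_integral_multc[symmetric]) (simp_all add: mult_ac)
    also have "\<dots> = (\<integral>\<^sup>+\<omega>. ennreal (1 / X \<omega>) * indicator A (U \<omega>) \<partial>M)"
      by (rule nn_integral_X_U[symmetric]) measurable
    also have "\<dots> = (\<integral>\<^sup>+\<omega>. ennreal (indicator A (U \<omega>) / X \<omega>) \<partial>M)"
      by (intro nn_integral_cong) (simp add: indicator_def)
    also have "\<dots> = ennreal (expectation (\<lambda>\<omega>. indicator A (U \<omega>) / X \<omega>))"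
      by (rule nn_integral_eq_integral[OF int nn])
    finally show "(\<integral>\<^sup>+u. ?a u * indicator A u \<partial>lborel) = ennreal (expectation (\<lambda>\<omega>. indicator A (U \<omega>) / X \<omega>))" .
    have meas: "(indicator A :: real \<Rightarrow> real) \<in> borel_measurable borel" by measurable
    note reg = inverse_regression_integral[OF meas int]
    have "AE \<omega> in M. 0 \<le> indicator A (U \<omega>) * (1 + U \<omega>) * \<beta>"
      using U_pos by eventually_elim (use beta_pos in simp)
    note reg' = nn_integral_eq_integral[OF reg(1) this]
    have "(\<integral>\<^sup>+u. ?b u * indicator A u \<partial>lborel) =
        (\<integral>\<^sup>+u. (\<integral>\<^sup>+x. ennreal (\<beta> * (1 + u)) * indicator A u * ennreal ((1 + x) * gd ((1 + x) * u)) \<partial>P) \<partial>lborel)"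
      by (subst nn_integral_multc[symmetric]) (simp_all add: mult_ac)
    also have "\<dots> = (\<integral>\<^sup>+\<omega>. ennreal (\<beta> * (1 + U \<omega>)) * indicator A (U \<omega>) \<partial>M)"
      by (rule nn_integral_X_U[symmetric]) measurable
    also have "\<dots> = (\<integral>\<^sup>+\<omega>. ennreal (indicator A (U \<omega>) * (1 + U \<omega>) * \<beta>) \<partial>M)"
      by (intro nn_integral_cong) (simp add: indicator_def mult.commute)
    finally show "(\<integral>\<^sup>+u. ?b u * indicator A u \<partial>lborel) = ennreal (expectation (\<lambda>\<omega>. indicator A (U \<omega>) / X \<omega>))"
      using reg(2) reg' by simp
  qed
  show "density lborel ?a = density lborel ?b"
    by (rule measure_eqI) (simp_all add: emeasure_density a b)
  \<comment> \<open>With \<open>A = UNIV\<close> the total mass is the expectation of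
    \<open>1 / X\<close>.\<close>
  show "integral\<^sup>N lborel ?a \<noteq> \<infinity>"
    using a[of UNIV] by simp
qed auto

lemma L_eq_D_AE: "AE u in lborel. u \<in> {0<..} \<longrightarrow> L (lam * u) - \<beta> * (1 + u) * D (lam * u) = 0"
  using densities_eq
proof eventually_elim
  case (elim u)
  show ?case
  proof
    assume "u \<in> {0<..}"
    then have u: "0 < u" "0 < lam * u" using lam_pos by auto
    \<comment> \<open>\<open>k\<close> collects the factors of the density at \<open>u\<close> that
      do not depend on \<open>x\<close>; it appears on both sides and is cancelled at the
      end.\<close>
    define k where "k = lam powr c / Gamma c * u powr (c - 1) * exp (- lam * u)"
    have k: "0 < k" unfolding k_def using lam_pos c_pos u Gamma_real_pos[OF c_pos] by simp
    have gd: "(1 + x) * gd ((1 + x) * u) = k * (x * w x * exp (- (lam * u) * x))" if "0 < x" for x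
    proof -
      have "exp (- lam * ((1 + x) * u)) = exp (- lam * u) * exp (- (lam * u) * x)"
        by (simp add: algebra_simps flip: exp_add)
      moreover have "(1 + x) * ((1 + x) * u) powr (c - 1) = (1 + x) powr c * u powr (c - 1)"
        using that u by (simp add: powr_mult powr_diff)
      moreover have "gd ((1 + x) * u) = lam powr c / Gamma c * (((1 + x) * u) powr (c - 1) * exp (- lam * ((1 + x) * u)))"
        using that u by (simp add: gd_def gamma_kernel_def)
      ultimately show ?thesis using that by (simp add: k_def w_def mult_ac)
    qed
    have "(\<integral>\<^sup>+x. ennreal (1 / x) * ennreal ((1 + x) * gd ((1 + x) * u)) \<partial>P) =
        (\<integral>\<^sup>+x. ennreal (k * (w x * exp (- (lam * u) * x))) \<partial>P)"
    proof (rule nn_integral_cong_AE)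
      show "AE x in P. ennreal (1 / x) * ennreal ((1 + x) * gd ((1 + x) * u)) = ennreal (k * (w x * exp (- (lam * u) * x)))"
        using P_pos
      proof eventually_elim
        case (elim x)
        then have "1 / x * (k * (x * w x * exp (- (lam * u) * x))) = k * (w x * exp (- (lam * u) * x))"
          by simp
        then show ?case using elim by (simp add: gd flip: ennreal_mult')
      qed
    qed
    also have "\<dots> = ennreal (LINT x|P. k * (w x * exp (- (lam * u) * x)))"
    proof (rule nn_integral_eq_integral)
      show "integrable P (\<lambda>x. k * (w x * exp (- (lam * u) * x)))"
        by (intro integrable_mult_right w_int u)
      show "AE x in P. 0 \<le> k * (w x * exp (- (lam * u) * x))"
        using P_pos by eventually_elim (use k in \<open>simp add: w_def\<close>)
    qed
    finally have a: "(\<integral>\<^sup>+x. ennreal (1 / x) * ennreal ((1 + x) * gd ((1 + x) * u)) \<partial>P) = ennreal (k * L (lam * u))"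
      by (simp add: L_def)
    have "(\<integral>\<^sup>+x. ennreal (\<beta> * (1 + u)) * ennreal ((1 + x) * gd ((1 + x) * u)) \<partial>P) =
        (\<integral>\<^sup>+x. ennreal (\<beta> * (1 + u) * k * (x * w x * exp (- (lam * u) * x))) \<partial>P)"
    proof (rule nn_integral_cong_AE)
      show "AE x in P. ennreal (\<beta> * (1 + u)) * ennreal ((1 + x) * gd ((1 + x) * u)) =
          ennreal (\<beta> * (1 + u) * k * (x * w x * exp (- (lam * u) * x)))"
        using P_pos by eventually_elim
          (use beta_pos u in \<open>simp add: gd mult.assoc flip: ennreal_mult'\<close>)
    qed
    also have "\<dots> = ennreal (LINT x|P. \<beta> * (1 + u) * k * (x * w x * exp (- (lam * u) * x)))"
    proof (rule nn_integral_eq_integral)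
      show "integrable P (\<lambda>x. \<beta> * (1 + u) * k * (x * w x * exp (- (lam * u) * x)))"
        by (intro integrable_mult_right xw_int u)
      show "AE x in P. 0 \<le> \<beta> * (1 + u) * k * (x * w x * exp (- (lam * u) * x))"
        using P_pos by eventually_elim (use k beta_pos u in \<open>simp add: w_def\<close>)
    qed
    finally have b: "(\<integral>\<^sup>+x. ennreal (\<beta> * (1 + u)) * ennreal ((1 + x) * gd ((1 + x) * u)) \<partial>P) =
        ennreal (\<beta> * (1 + u) * k * D (lam * u))"
      by (simp add: D_def)
    have "0 \<le> L (lam * u)" unfolding L_def
      using P_pos by (intro integral_nonneg_AE) (auto elim!: eventually_mono simp: w_def)
    moreover have "0 \<le> D (lam * u)" unfolding D_def
      using P_pos by (intro integral_nonneg_AE) (auto elim!: eventually_mono simp: w_def)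
    ultimately have "k * L (lam * u) = \<beta> * (1 + u) * k * D (lam * u)"
      using elim a b k u beta_pos by (simp add: ennreal_inj)
    then have "k * L (lam * u) = k * (\<beta> * (1 + u) * D (lam * u))"
      by (simp only: mult_ac)
    then show "L (lam * u) - \<beta> * (1 + u) * D (lam * u) = 0" using k by simp
  qed
qed

text \<open>Both sides are continuous, so the almost everywhere identity, read at
  \<open>u = t / lam\<close>, holds at every positive \<open>t\<close>.\<close>

lemma L_ode:
  assumes t: "0 < t"
  shows "L t = \<beta> * (1 + t / lam) * D t"
proof -
  have "continuous_on {0<..} (\<lambda>u. L (lam * u) - \<beta> * (1 + u) * D (lam * u))"
  proof (rule continuous_at_imp_continuous_on, rule ballI)
    fix u :: real assume "u \<in> {0<..}"
    then have u: "0 < lam * u" using lam_pos by simp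
    have "isCont L (lam * u)" by (rule DERIV_isCont[OF L_deriv[OF u]])
    then have "isCont (\<lambda>u. L (lam * u)) u" by (intro isCont_o2[of _ "\<lambda>u. lam * u" L]) simp_all
    moreover have "isCont (\<lambda>u. D (lam * u)) u"
      using D_isCont[OF u] by (intro isCont_o2[of _ "\<lambda>u. lam * u" D]) simp_all
    ultimately show "isCont (\<lambda>u. L (lam * u) - \<beta> * (1 + u) * D (lam * u)) u"
      by (intro continuous_intros)
  qed
  then have "L (lam * (t / lam)) - \<beta> * (1 + t / lam) * D (lam * (t / lam)) = 0"
    by (rule AE_zero_imp_zero_on_open[OF _ open_greaterThan L_eq_D_AE]) (use t lam_pos in simp)
  then show ?thesis using lam_pos by simp
qed

lemma distr_X:
  "\<exists>K>0. P = density lborel (\<lambda>x. ennreal (K * kummer_kernel (lam / \<beta> + 1) (c - (lam / \<beta> + 1)) lam x))"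
proof -
  obtain C where "\<forall>t>0. L t = C * (1 + t / lam) powr (- (lam / \<beta>))"
    using constant_of_Laplace_ode[OF L_deriv L_ode lam_pos beta_pos] by blast
  then show ?thesis
    by (intro eq_kummer_lawI_Laplace[OF real_distribution_P P_pos _ lam_pos])
       (use w_int lam_pos beta_pos in \<open>auto simp: w_def L_def\<close>)
qed

text \<open>Since \<open>lam\<close> is \<open>\<beta> / (\<alpha> * \<beta> - 1)\<close>, the
  exponent \<open>lam / \<beta>\<close> of the Laplace transform is
  \<open>1 / (\<alpha> * \<beta> - 1)\<close>, one less than the first Kummer parameter.\<close>

lemma parameters:
  "1 < \<alpha> * \<beta>" "\<beta> / (\<alpha> * \<beta> - 1) = lam" "\<alpha> * \<beta> / (\<alpha> * \<beta> - 1) = lam / \<beta> + 1"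
proof -
  have "0 < \<beta> * (\<alpha> - 1 / \<beta>)" using beta_pos delta_pos by simp
  then show *: "1 < \<alpha> * \<beta>" using beta_pos by (simp add: field_simps)
  show l: "\<beta> / (\<alpha> * \<beta> - 1) = lam" using beta_pos by (simp add: lam_def field_simps)
  have "lam / \<beta> = 1 / (\<alpha> * \<beta> - 1)" using beta_pos by (simp flip: l)
  then show "\<alpha> * \<beta> / (\<alpha> * \<beta> - 1) = lam / \<beta> + 1"
    using * by (simp only:) (simp add: field_simps)
qed

theorem kummer_gamma:
  "\<alpha> * \<beta> > 1 \<and>
    (\<exists>c>0.
      kummer_distributed M X (\<alpha> * \<beta> / (\<alpha> * \<beta> - 1)) (c - \<alpha> * \<beta> / (\<alpha> * \<beta> - 1)) (\<beta> / (\<alpha> * \<beta> - 1)) \<and>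
      gamma_distributed M Y c (\<beta> / (\<alpha> * \<beta> - 1)))"
  unfolding parameters(2,3)
proof (intro conjI exI[of _ c])
  show "\<alpha> * \<beta> > 1" by (rule parameters(1))
  show "c > 0" by (rule c_pos)
  \<comment> \<open>\<open>distributed\<close> takes the image law on \<open>lborel\<close>, whose
    sigma-algebra is that of \<open>borel\<close>, so both image laws coincide.\<close>
  have lborel: "distr M lborel Z = distr M borel Z" for Z :: "'a \<Rightarrow> real"
    by (rule distr_cong) auto
  obtain K where "K > 0" "P = density lborel (\<lambda>x. ennreal (K * kummer_kernel (lam / \<beta> + 1) (c - (lam / \<beta> + 1)) lam x))"
    using distr_X by blast
  moreover have "kummer_kernel a b d \<in> borel_measurable borel" for a b d
    unfolding kummer_kernel_def[abs_def] by measurable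
  moreover have "0 < lam / \<beta> + 1" using lam_pos beta_pos by (simp add: add_pos_pos)
  ultimately show "kummer_distributed M X (lam / \<beta> + 1) (c - (lam / \<beta> + 1)) lam"
    using lam_pos by (auto simp: kummer_distributed_def distributed_def lborel intro!: exI[of _ K])
  show "gamma_distributed M Y c lam"
    using lam_pos c_pos Gamma_real_pos[OF c_pos]
    by (auto simp: gamma_distributed_def distributed_def lborel distr_Y gamma_law_def
        intro!: exI[of _ "lam powr c / Gamma c"])
qed

end

theorem theorem2p1:
  fixes M :: "'a measure" and X Y U V :: "'a \<Rightarrow> real" and \<alpha> \<beta> :: real
  assumes "prob_space M"
    and "prob_space.indep_var M borel X borel Y"
    and "AE \<omega> in M. X \<omega> > 0" and "AE \<omega> in M. Y \<omega> > 0"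
    and "nondegenerate M X" and "nondegenerate M Y"
    and "integrable M X" and "integrable M Y"
    and "integrable M (\<lambda>\<omega>. inverse (X \<omega>))"
    and U: "U = (\<lambda>\<omega>. Y \<omega> / (1 + X \<omega>))"
    and V: "V = (\<lambda>\<omega>. X \<omega> * (1 + U \<omega>))"
    and "AE \<omega> in M. cond_exp_given M V U \<omega> = \<alpha>"
    and "AE \<omega> in M. cond_exp_given M (\<lambda>\<omega>. inverse (V \<omega>)) U \<omega> = \<beta>"
  shows "\<alpha> * \<beta> > 1 \<and>
    (\<exists>c>0.
      kummer_distributed M X (\<alpha> * \<beta> / (\<alpha> * \<beta> - 1)) (c - \<alpha> * \<beta> / (\<alpha> * \<beta> - 1)) (\<beta> / (\<alpha> * \<beta> - 1)) \<and>
      gamma_distributed M Y c (\<beta> / (\<alpha> * \<beta> - 1)))"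
proof -
  interpret regression_setting M X Y \<alpha> \<beta>
    using assms(1-4,6,8,9,12,13) unfolding regression_setting_def regression_setting_axioms_def
    by (simp add: U V)
  show ?thesis by (rule kummer_gamma)
qed

end
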